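(* There are absolute constants $k_0\in\mathbb N$ and $\alpha,\varepsilon>0$ such that for all integers $d\ge k\ge k_0$ and every $n\ge\alpha d^8k^6$ there is a pair of $k$-ary relational structures $\mathfrak A$ and $\mathfrak B$ with $|V(\mathfrak A)|=|V(\mathfrak B)|=n$ such that some sentence of $\mathsf{FO}^k$ is true in $\mathfrak A$ and false in $\mathfrak B$, but for every sentence $\psi$ of $\mathsf{FO}^d$ or of $\mathsf C^d$ of quantifier rank at most $n^{\varepsilon k}$ we have $\mathfrak A\models\psi$ iff $\mathfrak B\models\psi$.
   Context: $\mathsf{FO}$ is first-order logic over relational vocabularies (atomic formulas $x=y$, $R(x_1,\dots,x_r)$; $\wedge$, $\neg$, $\exists$). $\mathsf C$ extends it by counting quantifiers $\exists^{\ge j}x\,\varphi$. $\mathsf{FO}^k$ and $\mathsf C^k$ are the fragments using at most $k$ distinct variables (variables may be reused). Quantifier rank is the maximal nesting depth of quantifiers (counting quantifiers count as quantifiers). A $k$-ary structure has a finite universe and relations of arity at most $k$. *)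

theory Defs
  imports Complex_Main
begin

text \<open>A relational vocabulary is a partial map sending each of its symbols to its arity.\<close>

type_synonym 'r vocabulary = "'r \<rightharpoonup> nat"

record ('r, 'a) rel_structure =
  univ :: "'a set"
  interp :: "'r \<Rightarrow> 'a list set"

definition kary_vocabulary :: "nat \<Rightarrow> 'r vocabulary \<Rightarrow> bool" where
  "kary_vocabulary k \<tau> \<longleftrightarrow> finite (dom \<tau>) \<and> (\<forall>R r. \<tau> R = Some r \<longrightarrow> 1 \<le> r \<and> r \<le> k)"

text \<open>The value of \<open>interp\<close> on symbols outside the vocabulary is irrelevant.\<close>

definition finite_structure :: "'r vocabulary \<Rightarrow> ('r, 'a) rel_structure \<Rightarrow> bool" where
  "finite_structure \<tau> A \<longleftrightarrow> finite (univ A) \<and> univ A \<noteq> {} \<and>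
     (\<forall>R r. \<tau> R = Some r \<longrightarrow> interp A R \<subseteq> {as. length as = r \<and> set as \<subseteq> univ A})"

definition kary_structure :: "nat \<Rightarrow> 'r vocabulary \<Rightarrow> ('r, 'a) rel_structure \<Rightarrow> bool" where
  "kary_structure k \<tau> A \<longleftrightarrow> kary_vocabulary k \<tau> \<and> finite_structure \<tau> A"

text \<open>Formulas of first-order logic with counting; variables are natural numbers, and
  \<open>CEx j x \<phi>\<close> is the counting quantifier ``at least \<open>j\<close> elements \<open>x\<close> satisfy \<open>\<phi>\<close>''.\<close>

datatype 'r fm =
    Eq nat nat
  | Rel 'r "nat list"
  | Neg "'r fm"
  | Conj "'r fm" "'r fm"
  | Ex nat "'r fm"
  | CEx nat nat "'r fm"

primrec wf_fm :: "'r vocabulary \<Rightarrow> 'r fm \<Rightarrow> bool" where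
  "wf_fm \<tau> (Eq x y) \<longleftrightarrow> True"
| "wf_fm \<tau> (Rel R xs) \<longleftrightarrow> \<tau> R = Some (length xs)"
| "wf_fm \<tau> (Neg \<phi>) \<longleftrightarrow> wf_fm \<tau> \<phi>"
| "wf_fm \<tau> (Conj \<phi> \<psi>) \<longleftrightarrow> wf_fm \<tau> \<phi> \<and> wf_fm \<tau> \<psi>"
| "wf_fm \<tau> (Ex x \<phi>) \<longleftrightarrow> wf_fm \<tau> \<phi>"
| "wf_fm \<tau> (CEx j x \<phi>) \<longleftrightarrow> wf_fm \<tau> \<phi>"

primrec is_FO :: "'r fm \<Rightarrow> bool" where
  "is_FO (Eq x y) \<longleftrightarrow> True"
| "is_FO (Rel R xs) \<longleftrightarrow> True"
| "is_FO (Neg \<phi>) \<longleftrightarrow> is_FO \<phi>"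
| "is_FO (Conj \<phi> \<psi>) \<longleftrightarrow> is_FO \<phi> \<and> is_FO \<psi>"
| "is_FO (Ex x \<phi>) \<longleftrightarrow> is_FO \<phi>"
| "is_FO (CEx j x \<phi>) \<longleftrightarrow> False"

text \<open>All variables of a formula: free, bound, and those occurring only at a quantifier.\<close>

primrec vars :: "'r fm \<Rightarrow> nat set" where
  "vars (Eq x y) = {x, y}"
| "vars (Rel R xs) = set xs"
| "vars (Neg \<phi>) = vars \<phi>"
| "vars (Conj \<phi> \<psi>) = vars \<phi> \<union> vars \<psi>"
| "vars (Ex x \<phi>) = insert x (vars \<phi>)"
| "vars (CEx j x \<phi>) = insert x (vars \<phi>)"

primrec fv :: "'r fm \<Rightarrow> nat set" where
  "fv (Eq x y) = {x, y}"
| "fv (Rel R xs) = set xs"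
| "fv (Neg \<phi>) = fv \<phi>"
| "fv (Conj \<phi> \<psi>) = fv \<phi> \<union> fv \<psi>"
| "fv (Ex x \<phi>) = fv \<phi> - {x}"
| "fv (CEx j x \<phi>) = fv \<phi> - {x}"

primrec qrank :: "'r fm \<Rightarrow> nat" where
  "qrank (Eq x y) = 0"
| "qrank (Rel R xs) = 0"
| "qrank (Neg \<phi>) = qrank \<phi>"
| "qrank (Conj \<phi> \<psi>) = max (qrank \<phi>) (qrank \<psi>)"
| "qrank (Ex x \<phi>) = Suc (qrank \<phi>)"
| "qrank (CEx j x \<phi>) = Suc (qrank \<phi>)"

text \<open>The clause for \<open>CEx\<close> is meaningful for finite universes only, because of \<open>card\<close>.\<close>

primrec sat :: "('r, 'a) rel_structure \<Rightarrow> (nat \<Rightarrow> 'a) \<Rightarrow> 'r fm \<Rightarrow> bool" where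
  "sat A s (Eq x y) \<longleftrightarrow> s x = s y"
| "sat A s (Rel R xs) \<longleftrightarrow> map s xs \<in> interp A R"
| "sat A s (Neg \<phi>) \<longleftrightarrow> \<not> sat A s \<phi>"
| "sat A s (Conj \<phi> \<psi>) \<longleftrightarrow> sat A s \<phi> \<and> sat A s \<psi>"
| "sat A s (Ex x \<phi>) \<longleftrightarrow> (\<exists>a \<in> univ A. sat A (s(x := a)) \<phi>)"
| "sat A s (CEx j x \<phi>) \<longleftrightarrow> j \<le> card {a \<in> univ A. sat A (s(x := a)) \<phi>}"

text \<open>Truth of a sentence. For a sentence over a (nonempty) structure, the choice of the
  assignment does not matter.\<close>

definition models :: "('r, 'a) rel_structure \<Rightarrow> 'r fm \<Rightarrow> bool" where
  "models A \<phi> \<longleftrightarrow> (\<forall>s. range s \<subseteq> univ A \<longrightarrow> sat A s \<phi>)"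

definition C_sentences :: "'r vocabulary \<Rightarrow> nat \<Rightarrow> 'r fm set" where
  "C_sentences \<tau> k = {\<phi>. wf_fm \<tau> \<phi> \<and> fv \<phi> = {} \<and> card (vars \<phi>) \<le> k}"

definition FO_sentences :: "'r vocabulary \<Rightarrow> nat \<Rightarrow> 'r fm set" where
  "FO_sentences \<tau> k = {\<phi>. wf_fm \<tau> \<phi> \<and> is_FO \<phi> \<and> fv \<phi> = {} \<and> card (vars \<phi>) \<le> k}"

end

theory Submission
  imports Defs "HOL-Library.Z2" "HOL-Library.Function_Algebras" "HOL-Library.FuncSet"
begin

text \<open>
  The structures encode systems of XOR equations over \<open>n div 2\<close> variables; \<open>\<AA>\<close> and \<open>\<BB>\<close> differ only
  in the right-hand side of one equation. The equations trace a long linear computation in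
  blocks: the state of block \<open>t\<close> is the image of the state of block \<open>t - 1\<close> under a linear bijection
  \<open>T t\<close> of \<open>F\<^sub>2\<^sup>w\<close>, computed by prefix sums so that every equation has at most three terms. The
  initial state is \<open>0\<close>, and the last value is claimed to be \<open>0\<close> or \<open>1\<close>, respectively.
  Evaluating the computation step by step needs three registers only. On the other hand, for
  random \<open>T\<close> no sum of few values before a block coincides with a nonzero sum of few values after
  it, so a player with few pebbles who leaves a block untouched cannot relate the two sides; the
  contradiction can be pushed down by only \<open>d + 1\<close> blocks per round.

  To pack \<open>n\<^bsup>\<Omega>(k)\<^esup>\<close> values into few variables, each value is replaced by the XOR of \<open>\<Theta>(k)\<close>
  variables chosen by a random map (hardness condensation). By unique-neighbour expansion, \<open>d\<close>
  pebbled variables determine linear combinations of at most \<open>d\<close> values.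
\<close>

section \<open>Unique-neighbour expanders\<close>

text \<open>The obstacle is that d may be far larger than k while n is only polynomial in d:
  additional pebbles must not shorten the game. Hence the states are much wider than d, namely
  \<open>w = n ^ 3\<close>. There are fewer than \<open>h * (h * w ^ 2) ^ (2 * d + 1)\<close> ways
  to place few values on both sides of a block, and \<open>2 ^ w\<close> exceeds this number, so
  random maps avoid all coincidences at once. Invertibility makes the last value a nonzero form in
  the initial state, so that claiming the value 1 for it does not contradict the equations above an
  untouched block. Long and wide computations are affordable only because of condensation, whose
  price is arity: three values per equation, each the XOR of \<open>3 * e\<close> variables with
  \<open>e = k div 9\<close>. Since the equations of the second structure have no solution, no
  global flip can relate the structures; flips are controlled on the pebbled variables only and
  extended whenever a variable is added.\<close>

definition hits :: "(nat \<Rightarrow> nat \<Rightarrow> nat) \<Rightarrow> nat \<Rightarrow> nat set \<Rightarrow> nat \<Rightarrow> (nat \<times> nat) set" where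
  "hits \<gamma> D A v = {p \<in> A \<times> {..<D}. \<gamma> (fst p) (snd p) = v}"

text \<open>Incidences are counted as pairs because the D choices for one value may coincide. A
  variable met exactly once has odd parity and cannot cancel in an XOR.\<close>

definition unique_nbrs :: "(nat \<Rightarrow> nat \<Rightarrow> nat) \<Rightarrow> nat \<Rightarrow> nat set \<Rightarrow> nat set" where
  "unique_nbrs \<gamma> D A = {v. card (hits \<gamma> D A v) = 1}"

lemma finite_hits: "finite A \<Longrightarrow> finite (hits \<gamma> D A v)"
  by (simp add: hits_def)

lemma unique_nbrs_subset: "unique_nbrs \<gamma> D A \<subseteq> (\<lambda>p. \<gamma> (fst p) (snd p)) ` (A \<times> {..<D})"
proof
  fix v assume "v \<in> unique_nbrs \<gamma> D A"
  then have "hits \<gamma> D A v \<noteq> {}"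
    by (auto simp: unique_nbrs_def)
  then show "v \<in> (\<lambda>p. \<gamma> (fst p) (snd p)) ` (A \<times> {..<D})"
    by (force simp: hits_def)
qed

text \<open>Every neighbour that is not unique absorbs at least two of the \<open>D * card A\<close>
  incidences, so many neighbours force many unique ones.\<close>

lemma unique_nbrs_bound:
  assumes "finite A"
  shows "2 * card ((\<lambda>p. \<gamma> (fst p) (snd p)) ` (A \<times> {..<D})) \<le> D * card A + card (unique_nbrs \<gamma> D A)"
proof -
  let ?h = "\<lambda>p. \<gamma> (fst p) (snd p)"
  let ?I = "?h ` (A \<times> {..<D})"
  have fin: "finite (A \<times> {..<D})" using assms by simp
  have "card (A \<times> {..<D}) = (\<Sum>v\<in>?I. card (hits \<gamma> D A v))"
    using sum.image_gen[OF fin, of "\<lambda>_. 1::nat" ?h] by (simp add: hits_def)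
  then have s: "D * card A = (\<Sum>v\<in>?I. card (hits \<gamma> D A v))"
    by (simp add: card_cartesian_product mult.commute)
  have "(\<Sum>v\<in>?I. of_bool (v \<in> unique_nbrs \<gamma> D A)) = card (?I \<inter> unique_nbrs \<gamma> D A)"
    using fin by (simp add: sum_of_bool_eq)
  also have "?I \<inter> unique_nbrs \<gamma> D A = unique_nbrs \<gamma> D A"
    using unique_nbrs_subset by blast
  finally have u: "(\<Sum>v\<in>?I. of_bool (v \<in> unique_nbrs \<gamma> D A)) = card (unique_nbrs \<gamma> D A)" .
  have "2 * card ?I = (\<Sum>v\<in>?I. 2)" by simp
  also have "\<dots> \<le> (\<Sum>v\<in>?I. card (hits \<gamma> D A v) + of_bool (v \<in> unique_nbrs \<gamma> D A))"
  proof (rule sum_mono)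
    fix v assume "v \<in> ?I"
    then have "hits \<gamma> D A v \<noteq> {}" by (force simp: hits_def)
    then have "card (hits \<gamma> D A v) \<noteq> 0"
      using finite_hits[OF assms] by simp
    then show "2 \<le> card (hits \<gamma> D A v) + of_bool (v \<in> unique_nbrs \<gamma> D A)"
      by (cases "card (hits \<gamma> D A v) = 1") (auto simp: unique_nbrs_def)
  qed
  also have "\<dots> = D * card A + card (unique_nbrs \<gamma> D A)"
    using s u by (simp add: sum.distrib)
  finally show ?thesis .
qed

text \<open>The union bounds represent sets of bounded size by lists of one fixed length, padded by
  repetition, so that they are counted by a plain power.\<close>

lemma set_as_list_of_length:
  assumes "finite S" "S \<noteq> {}" "card S \<le> l"
  shows "\<exists>xs. set xs = S \<and> length xs = l"
proof -
  obtain ys where ys: "set ys = S" "distinct ys"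
    using finite_distinct_list[OF assms(1)] by blast
  obtain a where "a \<in> S" using assms(2) by blast
  then have "set (ys @ replicate (l - card S) a) = S" using ys by auto
  moreover have "length (ys @ replicate (l - card S) a) = l"
    using assms(3) ys distinct_card by fastforce
  ultimately show ?thesis by blast
qed

lemma card_maps_into_le:
  assumes "set xs \<subseteq> {..<M}" "card (set xs) = a" "length zs = z"
  shows "card (PiE ({..<M} \<times> {..<D}) (\<lambda>p. if fst p \<in> set xs then set zs else {..<m}))
         \<le> z ^ (D * a) * m ^ (D * (M - a))"
proof -
  let ?A = "set xs"
  have split: "{..<M} \<times> {..<D} = (?A \<times> {..<D}) \<union> (({..<M} - ?A) \<times> {..<D})"
    using assms(1) by auto
  have "card (PiE ({..<M} \<times> {..<D}) (\<lambda>p. if fst p \<in> ?A then set zs else {..<m}))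
      = (\<Prod>p\<in>{..<M} \<times> {..<D}. card (if fst p \<in> ?A then set zs else {..<m}))"
    by (simp add: card_PiE)
  also have "\<dots> = (\<Prod>p\<in>?A \<times> {..<D}. card (if fst p \<in> ?A then set zs else {..<m}))
      * (\<Prod>p\<in>({..<M} - ?A) \<times> {..<D}. card (if fst p \<in> ?A then set zs else {..<m}))"
    unfolding split by (rule prod.union_disjoint) auto
  also have "(\<Prod>p\<in>?A \<times> {..<D}. card (if fst p \<in> ?A then set zs else {..<m}))
      = (\<Prod>p\<in>?A \<times> {..<D}. card (set zs))"
    by (rule prod.cong) auto
  also have "\<dots> = card (set zs) ^ (D * a)"
    using assms by (simp add: card_cartesian_product mult.commute)
  also have "(\<Prod>p\<in>({..<M} - ?A) \<times> {..<D}. card (if fst p \<in> ?A then set zs else {..<m}))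
      = (\<Prod>p\<in>({..<M} - ?A) \<times> {..<D}. m)"
    by (rule prod.cong) auto
  also have "\<dots> = m ^ (D * (M - a))"
    using assms by (simp add: card_cartesian_product card_Diff_subset mult.commute)
  also have "card (set zs) ^ (D * a) * m ^ (D * (M - a)) \<le> z ^ (D * a) * m ^ (D * (M - a))"
    using card_length[of zs] assms(3) by (simp add: power_mono)
  finally show ?thesis .
qed

text \<open>A union bound: a uniformly random map has the expansion property with positive probability.\<close>

lemma expander_exists:
  fixes e d M m :: nat
  assumes e: "1 \<le> e" and d: "1 \<le> d" and M: "1 \<le> M"
    and bound: "4 * d * M * (4 * e * d) ^ (3 * e) \<le> m ^ e"
  obtains \<gamma> where "\<And>u i. u < M \<Longrightarrow> i < 3 * e \<Longrightarrow> \<gamma> u i < m"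
    and "\<And>A. A \<subseteq> {..<M} \<Longrightarrow> card A \<le> 2 * d \<Longrightarrow> card A \<le> card (unique_nbrs \<gamma> (3 * e) A)"
proof -
  define D where "D = 3 * e"
  define I where "I = {..<M} \<times> {..<D}"
  define \<Omega> where "\<Omega> = PiE I (\<lambda>_. {..<m})"
  define F where "F xs zs = PiE I (\<lambda>p. if fst p \<in> set xs then set zs else {..<m})"
    for xs zs :: "nat list"
  define XS where "XS a = {xs. set xs \<subseteq> {..<M} \<and> length xs = a}" for a
  define ZS where "ZS a = {zs. set zs \<subseteq> {..<m} \<and> length zs = 2 * e * a}" for a
  define XD where "XD a = {xs \<in> XS a. card (set xs) = a}" for a
  define Bad where "Bad a = (\<Union>q\<in>XD a \<times> ZS a. F (fst q) (snd q))" for a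
  have mpos: "m > 0"
  proof (rule ccontr)
    assume "\<not> m > 0"
    then have "4 * d * M * (4 * e * d) ^ (3 * e) = 0" using bound e by (simp add: power_0_left)
    then show False using e d M by simp
  qed
  have finXS: "finite (XS a)" and cXS: "card (XS a) = M ^ a" for a
    using finite_lists_length_eq[of "{..<M}" a] card_lists_length_eq[of "{..<M}" a]
    by (simp_all add: XS_def)
  have finZS: "finite (ZS a)" and cZS: "card (ZS a) = m ^ (2 * e * a)" for a
    using finite_lists_length_eq[of "{..<m}" "2 * e * a"] card_lists_length_eq[of "{..<m}" "2 * e * a"]
    by (simp_all add: ZS_def)
  have finXD: "finite (XD a)" for a using finXS[of a] by (simp add: XD_def)
  have cXD: "card (XD a) \<le> M ^ a" for a
    using card_mono[OF finXS[of a], of "XD a"] cXS[of a] by (auto simp: XD_def)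
  have c\<Omega>: "card \<Omega> = m ^ (D * M)"
    by (simp add: \<Omega>_def I_def card_PiE card_cartesian_product mult.commute)
  have fin\<Omega>: "finite \<Omega>" by (auto simp: \<Omega>_def I_def intro!: finite_PiE)
  \<comment> \<open>Choosing the target of \<open>2 * e * a\<close> variables costs a factor
    \<open>m ^ (2 * e * a)\<close>, but confining \<open>a\<close> values to it gains
    \<open>m ^ (3 * e * a)\<close>. The surplus \<open>m ^ e\<close> per value is what
    \<open>bound\<close> sets against the remaining factors.\<close>
  have Bad_le: "4 * d * card (Bad a) \<le> card \<Omega>" if a: "1 \<le> a" "a \<le> 2 * d" "a \<le> M" for a
  proof -
    have "card (Bad a) \<le> (\<Sum>q\<in>XD a \<times> ZS a. card (F (fst q) (snd q)))"
      unfolding Bad_def using finXD finZS by (intro card_UN_le) simp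
    also have "\<dots> \<le> (\<Sum>q\<in>XD a \<times> ZS a. (2 * e * a) ^ (D * a) * m ^ (D * (M - a)))"
      unfolding F_def I_def
      by (intro sum_mono card_maps_into_le) (auto simp: XD_def XS_def ZS_def)
    also have "\<dots> = card (XD a) * m ^ (2 * e * a) * ((2 * e * a) ^ (D * a) * m ^ (D * (M - a)))"
      by (simp add: card_cartesian_product cZS)
    also have "\<dots> \<le> M ^ a * m ^ (2 * e * a) * ((2 * e * a) ^ (D * a) * m ^ (D * (M - a)))"
      using cXD by (intro mult_right_mono) auto
    finally have "4 * d * card (Bad a)
        \<le> 4 * d * (M ^ a * m ^ (2 * e * a) * ((2 * e * a) ^ (D * a) * m ^ (D * (M - a))))"
      by simp
    \<comment> \<open>The factor \<open>4 * d\<close> moves under the exponent \<open>a\<close>, so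
      that \<open>bound\<close> applies once per value.\<close>
    also have "\<dots> \<le> (4 * d) ^ a * (M ^ a * m ^ (2 * e * a) * ((4 * e * d) ^ (D * a) * m ^ (D * (M - a))))"
    proof -
      have "4 * d \<le> (4 * d) ^ a" using a(1) d by (intro self_le_power) auto
      moreover have "(2 * e * a) ^ (D * a) \<le> (4 * e * d) ^ (D * a)"
        using a(2) by (intro power_mono) auto
      ultimately show ?thesis by (intro mult_mono) auto
    qed
    also have "\<dots> = (4 * d * M * (4 * e * d) ^ (3 * e)) ^ a * m ^ (2 * e * a) * m ^ (D * (M - a))"
    proof -
      define c where "c = (4 * e * d) ^ (3 * e)"
      have c: "(4 * e * d) ^ (D * a) = c ^ a" by (simp only: c_def D_def flip: power_mult)
      show ?thesis unfolding c c_def[symmetric] by (simp only: power_mult_distrib mult_ac)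
    qed
    also have "\<dots> \<le> (m ^ e) ^ a * m ^ (2 * e * a) * m ^ (D * (M - a))"
      using bound by (intro mult_right_mono power_mono) auto
    also have "\<dots> = m ^ (e * a + 2 * e * a + D * (M - a))"
      by (simp only: power_add power_mult)
    also have "e * a + 2 * e * a + D * (M - a) = D * M"
      using a(3) by (simp add: D_def algebra_simps diff_mult_distrib2)
    finally show ?thesis using c\<Omega> by simp
  qed
  have Bad_sub: "F xs zs \<subseteq> \<Omega>" if "xs \<in> XD a" "zs \<in> ZS a" for a xs zs
    using that unfolding F_def \<Omega>_def by (intro PiE_mono) (auto simp: ZS_def)
  \<comment> \<open>Sizes up to \<open>2 * d\<close> are covered because unions of two sets of size
    d arise later. At most \<open>2 * d\<close> sizes, each of density at most
    \<open>1 / (4 * d)\<close>, leave at least half of all maps.\<close>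
  let ?R = "{a. 1 \<le> a \<and> a \<le> 2 * d \<and> a \<le> M}"
  have finR: "finite ?R" by (rule finite_subset[of _ "{..2*d}"]) auto
  have cR: "card ?R \<le> 2 * d"
  proof -
    have "card ?R \<le> card {1..2*d}" by (intro card_mono) auto
    then show ?thesis by simp
  qed
  have "4 * d * card (\<Union>a\<in>?R. Bad a) \<le> 4 * d * (\<Sum>a\<in>?R. card (Bad a))"
    by (intro mult_left_mono card_UN_le finR) auto
  also have "\<dots> = (\<Sum>a\<in>?R. 4 * d * card (Bad a))" by (simp add: sum_distrib_left)
  also have "\<dots> \<le> (\<Sum>a\<in>?R. card \<Omega>)" using Bad_le by (intro sum_mono) auto
  also have "\<dots> \<le> 2 * d * card \<Omega>" using cR by simp
  finally have "2 * card (\<Union>a\<in>?R. Bad a) \<le> card \<Omega>" using d by simp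
  moreover have "card \<Omega> > 0" using c\<Omega> mpos by simp
  ultimately have lt: "card (\<Union>a\<in>?R. Bad a) < card \<Omega>" by linarith
  have "\<not> \<Omega> \<subseteq> (\<Union>a\<in>?R. Bad a)"
  proof
    assume "\<Omega> \<subseteq> (\<Union>a\<in>?R. Bad a)"
    moreover have "(\<Union>a\<in>?R. Bad a) \<subseteq> \<Omega>"
      unfolding Bad_def using Bad_sub by fastforce
    ultimately show False using lt by (metis less_irrefl subset_antisym)
  qed
  then obtain \<phi> where \<phi>: "\<phi> \<in> \<Omega>" "\<And>a. a \<in> ?R \<Longrightarrow> \<phi> \<notin> Bad a" by blast
  define \<gamma> where "\<gamma> u i = \<phi> (u, i)" for u i
  show ?thesis
  proof
    fix u i assume "u < M" "i < 3 * e"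
    then show "\<gamma> u i < m" using \<phi>(1) by (auto simp: \<gamma>_def \<Omega>_def I_def D_def PiE_def Pi_def)
  next
    fix A assume A: "A \<subseteq> {..<M}" "card A \<le> 2 * d"
    show "card A \<le> card (unique_nbrs \<gamma> (3 * e) A)"
    proof (cases "A = {}")
      case False
      have finA: "finite A" using A(1) finite_subset by blast
      define a where "a = card A"
      have aR: "a \<in> ?R"
        using False finA A card_mono[OF _ A(1)] by (auto simp: a_def Suc_le_eq card_gt_0_iff)
      let ?J = "(\<lambda>p. \<gamma> (fst p) (snd p)) ` (A \<times> {..<D})"
      \<comment> \<open>With \<open>3 * e * a\<close> incidences, \<open>2 * e * a\<close> distinct
        neighbours leave at least \<open>4 * e * a - 3 * e * a = e * a\<close> unique ones.\<close>
      have J: "2 * e * a \<le> card ?J"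
      proof (rule ccontr)
        assume "\<not> 2 * e * a \<le> card ?J"
        moreover have "finite ?J" using finA by simp
        moreover have "?J \<noteq> {}" using False e by (auto simp: D_def lessThan_empty_iff)
        ultimately obtain zs where zs: "set zs = ?J" "length zs = 2 * e * a"
          using set_as_list_of_length[of ?J "2 * e * a"] by auto
        obtain xs where xs: "set xs = A" "length xs = a"
          using set_as_list_of_length[OF finA False, of a] by (auto simp: a_def)
        have "?J \<subseteq> {..<m}"
          using A(1) \<phi>(1) by (auto simp: \<gamma>_def \<Omega>_def I_def PiE_def Pi_def)
        then have "zs \<in> ZS a" using zs by (auto simp: ZS_def)
        moreover have "xs \<in> XD a" using xs A(1) by (auto simp: XD_def XS_def a_def)
        moreover have "\<phi> \<in> F xs zs"
          using \<phi>(1) unfolding F_def \<Omega>_def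
          by (auto simp: PiE_def Pi_def zs(1) xs(1) I_def \<gamma>_def intro!: image_eqI)
        ultimately have "\<phi> \<in> Bad a" by (auto simp: Bad_def)
        then show False using \<phi>(2)[OF aR] by simp
      qed
      have "2 * card ?J \<le> D * a + card (unique_nbrs \<gamma> D A)"
        using unique_nbrs_bound[OF finA] by (simp add: a_def)
      then have "e * a \<le> card (unique_nbrs \<gamma> D A)" using J by (simp add: D_def)
      moreover have "a \<le> e * a" using e by simp
      ultimately have "a \<le> card (unique_nbrs \<gamma> D A)" by (rule order_trans[rotated])
      then show ?thesis by (simp only: a_def D_def)
    qed simp
  qed
qed

section \<open>Linear maps over the two-element field\<close>

definition vecs :: "nat \<Rightarrow> (nat \<Rightarrow> bit) set" where
  "vecs w = {z. \<forall>c\<ge>w. z c = 0}"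

definition unitv :: "nat \<Rightarrow> nat \<Rightarrow> bit" where
  "unitv i = (\<lambda>c. of_bool (c = i))"

definition trunc :: "nat \<Rightarrow> (nat \<Rightarrow> bit) \<Rightarrow> nat \<Rightarrow> bit" where
  "trunc j z = (\<lambda>c. if c \<le> j then z c else 0)"

lemma bit_add_self: "(x::bit) + x = 0"
  by (cases x) simp_all

lemma vec_add_self: "(z::nat \<Rightarrow> bit) + z = 0"
  by (rule ext) (simp add: bit_add_self)

lemma vecs_zero: "0 \<in> vecs w" by (simp add: vecs_def)
lemma vecs_add: "x \<in> vecs w \<Longrightarrow> y \<in> vecs w \<Longrightarrow> x + y \<in> vecs w" by (simp add: vecs_def)
lemma vecs_unitv: "i < w \<Longrightarrow> unitv i \<in> vecs w" by (auto simp: vecs_def unitv_def)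
lemma vecs_trunc: "z \<in> vecs w \<Longrightarrow> trunc j z \<in> vecs w" by (auto simp: vecs_def trunc_def)

lemma vecs_sum: "(\<And>u. u \<in> A \<Longrightarrow> z u \<in> vecs w) \<Longrightarrow> sum z A \<in> vecs w"
  by (induction A rule: infinite_finite_induct) (simp_all add: vecs_zero vecs_add)

lemma unitv_nonzero: "unitv i \<noteq> 0"
proof
  assume "unitv i = 0"
  then have "unitv i i = 0" by simp
  then show False by (simp add: unitv_def)
qed

lemma trunc_full: "z \<in> vecs w \<Longrightarrow> trunc (w - 1) z = z"
  by (rule ext) (auto simp: trunc_def vecs_def)

lemma trunc_step: "trunc j z = (if j = 0 then 0 else trunc (j - 1) z) + (if z j = 1 then unitv j else 0)"
proof (rule ext)
  fix c
  have "c < j \<or> c = j \<or> c > j" by auto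
  then show "trunc j z c = ((if j = 0 then 0 else trunc (j - 1) z) + (if z j = 1 then unitv j else 0)) c"
    by (elim disjE) (auto simp: trunc_def unitv_def)
qed

lemma bij_betw_vecs: "bij_betw (\<lambda>S c. of_bool (c \<in> S)) (Pow {..<w}) (vecs w)"
proof (rule bij_betwI[where g = "\<lambda>z. {c. z c = 1}"])
  show "(\<lambda>S c. of_bool (c \<in> S)) \<in> Pow {..<w} \<rightarrow> vecs w" by (auto simp: vecs_def)
  show "(\<lambda>z. {c. z c = 1}) \<in> vecs w \<rightarrow> Pow {..<w}"
    by (force simp: vecs_def not_le[symmetric])
  show "{c. of_bool (c \<in> S) = (1::bit)} = S" for S :: "nat set" by auto
  show "(\<lambda>c. of_bool (c \<in> {c. z c = 1})) = z" for z :: "nat \<Rightarrow> bit" by (rule ext) auto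
qed

lemma finite_vecs: "finite (vecs w)"
  using bij_betw_finite[OF bij_betw_vecs] by simp

lemma card_vecs: "card (vecs w) = 2 ^ w"
  using bij_betw_same_card[OF bij_betw_vecs, of w] by (simp add: card_Pow)

section \<open>Injective linear maps and transvections\<close>

definition inj_linear :: "nat \<Rightarrow> ((nat \<Rightarrow> bit) \<Rightarrow> nat \<Rightarrow> bit) \<Rightarrow> bool" where
  "inj_linear w \<tau> \<longleftrightarrow> (\<forall>x\<in>vecs w. \<tau> x \<in> vecs w) \<and>
     (\<forall>x\<in>vecs w. \<forall>y\<in>vecs w. \<tau> (x + y) = \<tau> x + \<tau> y) \<and> inj_on \<tau> (vecs w)"

lemma inj_linear_vecs: "inj_linear w \<tau> \<Longrightarrow> x \<in> vecs w \<Longrightarrow> \<tau> x \<in> vecs w"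
  by (simp add: inj_linear_def)

lemma inj_linear_add:
  "inj_linear w \<tau> \<Longrightarrow> x \<in> vecs w \<Longrightarrow> y \<in> vecs w \<Longrightarrow> \<tau> (x + y) = \<tau> x + \<tau> y"
  by (simp add: inj_linear_def)

lemma inj_linear_zero: "inj_linear w \<tau> \<Longrightarrow> \<tau> 0 = 0"
  using inj_linear_add[of w \<tau> 0 0] vecs_zero[of w] by simp

lemma inj_linear_eq: "inj_linear w \<tau> \<Longrightarrow> x \<in> vecs w \<Longrightarrow> y \<in> vecs w \<Longrightarrow> \<tau> x = \<tau> y \<Longrightarrow> x = y"
  by (simp add: inj_linear_def inj_on_def)

lemma inj_linear_nonzero: "inj_linear w \<tau> \<Longrightarrow> x \<in> vecs w \<Longrightarrow> x \<noteq> 0 \<Longrightarrow> \<tau> x \<noteq> 0"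
  using inj_linear_eq[of w \<tau> x 0] inj_linear_zero[of w \<tau>] vecs_zero[of w] by auto

lemma inj_linear_sum:
  assumes "inj_linear w \<tau>" "\<And>u. u \<in> A \<Longrightarrow> z u \<in> vecs w"
  shows "\<tau> (sum z A) = (\<Sum>u\<in>A. \<tau> (z u))"
  using assms(2)
  by (induction A rule: infinite_finite_induct)
     (simp_all add: inj_linear_zero[OF assms(1)] inj_linear_add[OF assms(1)] vecs_sum)

lemma inj_linear_id: "inj_linear w id"
  by (simp add: inj_linear_def)

lemma inj_linear_comp:
  assumes \<sigma>: "inj_linear w \<sigma>" and \<tau>: "inj_linear w \<tau>"
  shows "inj_linear w (\<sigma> \<circ> \<tau>)"
proof -
  have "inj_on (\<sigma> \<circ> \<tau>) (vecs w)"
    by (rule inj_onI) (metis \<sigma> \<tau> comp_apply inj_linear_eq inj_linear_vecs)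
  then show ?thesis
    unfolding inj_linear_def comp_apply
    using inj_linear_vecs[OF \<sigma>] inj_linear_vecs[OF \<tau>]
    by (simp add: inj_linear_add[OF \<sigma>] inj_linear_add[OF \<tau>])
qed

text \<open>Extensionality leaves one function per linear map, so that the maps form a finite set
  and probabilities become ratios of cardinalities.\<close>

definition GL :: "nat \<Rightarrow> ((nat \<Rightarrow> bit) \<Rightarrow> nat \<Rightarrow> bit) set" where
  "GL w = {\<tau> \<in> vecs w \<rightarrow>\<^sub>E vecs w. inj_linear w \<tau>}"

lemma finite_GL: "finite (GL w)"
proof (rule finite_subset)
  show "GL w \<subseteq> vecs w \<rightarrow>\<^sub>E vecs w" unfolding GL_def by blast
  show "finite (vecs w \<rightarrow>\<^sub>E vecs w)" by (intro finite_PiE finite_vecs)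
qed

lemma inj_linear_restrict: "inj_linear w \<tau> \<Longrightarrow> restrict \<tau> (vecs w) \<in> GL w"
proof -
  assume \<tau>: "inj_linear w \<tau>"
  have "restrict \<tau> (vecs w) \<in> vecs w \<rightarrow>\<^sub>E vecs w"
    by (simp add: inj_linear_vecs[OF \<tau>])
  moreover have "inj_on (restrict \<tau> (vecs w)) (vecs w)"
    using \<tau> by (simp add: inj_linear_def)
  ultimately show ?thesis
    using \<tau> by (simp add: GL_def inj_linear_def vecs_add)
qed

lemma GL_nonempty: "GL w \<noteq> {}"
  using inj_linear_restrict[OF inj_linear_id] by blast

text \<open>If a functional \<open>\<phi>\<close> is 1 on both x and y, it vanishes on x + y, so
  adding x + y to the vectors with \<open>\<phi> z = 1\<close> is an involution exchanging x and y.
  Such a functional is a coordinate that is 1 in both vectors or else the sum of a coordinate of x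
  and one of y.\<close>

lemma transvection_exists:
  assumes "x \<in> vecs w" "y \<in> vecs w" "x \<noteq> 0" "y \<noteq> 0"
  shows "\<exists>\<tau>. inj_linear w \<tau> \<and> \<tau> x = y"
proof -
  obtain a where a: "x a = 1" using assms(3) by (auto simp: fun_eq_iff)
  obtain b where b: "y b = 1" using assms(4) by (auto simp: fun_eq_iff)
  define \<phi> :: "(nat \<Rightarrow> bit) \<Rightarrow> bit" where
    "\<phi> z = (if y a = 1 then z a else if x b = 1 then z b else z a + z b)" for z
  have add: "\<phi> (z + z') = \<phi> z + \<phi> z'" for z z'
    by (cases "z a"; cases "z b"; cases "z' a"; cases "z' b") (simp_all add: \<phi>_def)
  have one: "\<phi> x = 1" "\<phi> y = 1" using a b by (auto simp: \<phi>_def)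
  define u where "u = x + y"
  have u0: "\<phi> u = 0" using one add by (simp add: u_def)
  have uW: "u \<in> vecs w" using assms by (simp add: u_def vecs_add)
  define \<tau> where "\<tau> z = z + (if \<phi> z = 1 then u else 0)" for z
  have inv: "\<tau> (\<tau> z) = z" for z
  proof -
    have "\<phi> (\<tau> z) = \<phi> z" using u0 add by (auto simp: \<tau>_def \<phi>_def)
    then show ?thesis by (auto simp: \<tau>_def add.assoc vec_add_self)
  qed
  have "\<tau> (z + z') = \<tau> z + \<tau> z'" for z z'
  proof -
    have "u + u = 0" by (rule vec_add_self)
    then have "u + (u + v) = v" for v by (simp flip: add.assoc)
    then show ?thesis
      using \<open>u + u = 0\<close> by (cases "\<phi> z"; cases "\<phi> z'") (simp_all add: \<tau>_def add add_ac)
  qed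
  moreover have "\<tau> z \<in> vecs w" if "z \<in> vecs w" for z
    using that uW vecs_add vecs_zero by (auto simp: \<tau>_def)
  moreover have "inj_on \<tau> (vecs w)" by (metis inv inj_onI)
  ultimately have "inj_linear w \<tau>" by (simp add: inj_linear_def)
  moreover have "\<tau> x = y"
    using one vec_add_self[of x] by (simp add: \<tau>_def u_def flip: add.assoc)
  ultimately show ?thesis by blast
qed

text \<open>Linear forms pull back in reverse order: a form in the state of block
  \<open>g + n\<close> is rewritten by \<open>T (g + n)\<close> first and by
  \<open>T (g + 1)\<close> last. Accordingly \<open>T t (unitv i)\<close> is row i of the matrix of
  block t.\<close>

primrec comp_from :: "(nat \<Rightarrow> (nat \<Rightarrow> bit) \<Rightarrow> nat \<Rightarrow> bit) \<Rightarrow> nat \<Rightarrow> nat \<Rightarrow> (nat \<Rightarrow> bit) \<Rightarrow> nat \<Rightarrow> bit" where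
  "comp_from T g 0 = id"
| "comp_from T g (Suc n) = comp_from T g n \<circ> T (Suc (g + n))"

lemma comp_from_cong:
  "(\<And>t. g < t \<Longrightarrow> t \<le> g + n \<Longrightarrow> T t = S t) \<Longrightarrow> comp_from T g n = comp_from S g n"
  by (induction n) auto

lemma comp_from_inj_linear:
  "(\<And>t. g < t \<Longrightarrow> t \<le> g + n \<Longrightarrow> inj_linear w (T t)) \<Longrightarrow> inj_linear w (comp_from T g n)"
  by (induction n) (auto intro!: inj_linear_id inj_linear_comp)

lemma comp_from_split: "comp_from T 0 (g + n) = comp_from T 0 g \<circ> comp_from T g n"
  by (induction n) (auto simp: fun_eq_iff)

text \<open>The values of the computation as linear forms in the initial state: \<open>layer_vec T t i j\<close> is
  the prefix sum up to column \<open>j\<close> of row \<open>i\<close> of \<open>T t\<close> applied to the state of block \<open>t - 1\<close>, so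
  that column \<open>w - 1\<close> holds the state of block \<open>t\<close>. \<open>rel_vec T g\<close> is the same value as a linear
  form in the state of block \<open>g\<close>.\<close>

definition layer_vec :: "(nat \<Rightarrow> (nat \<Rightarrow> bit) \<Rightarrow> nat \<Rightarrow> bit) \<Rightarrow> nat \<Rightarrow> nat \<Rightarrow> nat \<Rightarrow> nat \<Rightarrow> bit" where
  "layer_vec T t i j =
     (if t = 0 then unitv i else comp_from T 0 (t - 1) (trunc j (T t (unitv i))))"

definition rel_vec :: "(nat \<Rightarrow> (nat \<Rightarrow> bit) \<Rightarrow> nat \<Rightarrow> bit) \<Rightarrow> nat \<Rightarrow> nat \<Rightarrow> nat \<Rightarrow> nat \<Rightarrow> nat \<Rightarrow> bit" where
  "rel_vec T g t i j = comp_from T g (t - 1 - g) (trunc j (T t (unitv i)))"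

text \<open>Isolates the map at the gap: \<open>rel_vec T g\<close> involves only later maps and the
  outer factor only earlier ones, so \<open>T g\<close> stays random when both are fixed.\<close>

lemma layer_vec_eq_rel_vec:
  assumes "1 \<le> g" "g < t"
  shows "layer_vec T t i j = comp_from T 0 (g - 1) (T g (rel_vec T g t i j))"
proof -
  have "comp_from T 0 g = comp_from T 0 (g - 1) \<circ> T g"
    using assms(1) by (cases g) simp_all
  moreover have "comp_from T 0 (t - 1) = comp_from T 0 g \<circ> comp_from T g (t - 1 - g)"
    using comp_from_split[of T g "t - 1 - g"] assms by simp
  ultimately show ?thesis
    using assms by (simp add: layer_vec_def rel_vec_def del: One_nat_def)
qed

lemma rel_vec_vecs:
  assumes "\<And>s. g < s \<Longrightarrow> s \<le> t \<Longrightarrow> inj_linear w (T s)" "i < w" "g < t"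
  shows "rel_vec T g t i j \<in> vecs w"
proof -
  have L: "inj_linear w (comp_from T g (t - 1 - g))"
    using assms(1) by (intro comp_from_inj_linear) auto
  have "T t (unitv i) \<in> vecs w"
    using assms(3) by (intro inj_linear_vecs[OF assms(1)] vecs_unitv assms(2)) auto
  then show ?thesis
    unfolding rel_vec_def by (intro inj_linear_vecs[OF L] vecs_trunc)
qed

text \<open>Extending the truncation to column j adds at most \<open>unitv j\<close>, whose pullback
  is coordinate j of the previous state, kept there in column \<open>w - 1\<close>.\<close>

lemma layer_vec_step:
  assumes lin: "\<And>s. 1 \<le> s \<Longrightarrow> s \<le> t \<Longrightarrow> inj_linear w (T s)" and "i < w" "j < w" "1 \<le> t"
  shows "layer_vec T t i j = (if j = 0 then 0 else layer_vec T t i (j - 1))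
           + (if T t (unitv i) j = 1 then layer_vec T (t - 1) j (w - 1) else 0)"
proof -
  let ?L = "comp_from T 0 (t - 1)"
  let ?z = "T t (unitv i)"
  have L: "inj_linear w ?L" using lin by (intro comp_from_inj_linear) auto
  have z: "?z \<in> vecs w" using assms(4) by (intro inj_linear_vecs[OF lin] vecs_unitv assms(2)) auto
  have unit: "?L (unitv j) = layer_vec T (t - 1) j (w - 1)"
  proof (cases "t = 1")
    \<comment> \<open>Block 0 repeats its unit vector in every column, so that column
      \<open>w - 1\<close> can be read as in any other block.\<close>
    case True then show ?thesis by (simp add: layer_vec_def)
  next
    case False
    then obtain t' where t': "t = Suc (Suc t')" using assms(4) by (intro that[of "t - 2"]) simp
    have "T (Suc t') (unitv j) \<in> vecs w"
      using t' by (intro inj_linear_vecs[OF lin] vecs_unitv assms(3)) auto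
    then show ?thesis using t' trunc_full[of "T (Suc t') (unitv j)" w] by (simp add: layer_vec_def)
  qed
  have "layer_vec T t i j = ?L (trunc j ?z)" using assms(4) by (simp add: layer_vec_def)
  also have "\<dots> = ?L ((if j = 0 then 0 else trunc (j - 1) ?z) + (if ?z j = 1 then unitv j else 0))"
    using trunc_step[of j ?z] by (rule arg_cong)
  also have "\<dots> = ?L (if j = 0 then 0 else trunc (j - 1) ?z) + ?L (if ?z j = 1 then unitv j else 0)"
    using z assms(3) by (intro inj_linear_add[OF L]) (simp_all add: vecs_zero vecs_trunc vecs_unitv)
  also have "?L (if j = 0 then 0 else trunc (j - 1) ?z) = (if j = 0 then 0 else layer_vec T t i (j - 1))"
    using assms(4) inj_linear_zero[OF L] by (simp add: layer_vec_def)
  also have "?L (if ?z j = 1 then unitv j else 0) = (if ?z j = 1 then layer_vec T (t - 1) j (w - 1) else 0)"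
    using unit inj_linear_zero[OF L] by (simp only: if_distrib[of ?L])
  finally show ?thesis .
qed

section \<open>The linear computation\<close>

text \<open>The value with coordinates \<open>t, i, j\<close> has index \<open>(t * w + i) * w + j\<close>.\<close>

definition block :: "nat \<Rightarrow> nat \<Rightarrow> nat" where "block w u = u div (w * w)"
definition row :: "nat \<Rightarrow> nat \<Rightarrow> nat" where "row w u = u div w mod w"
definition col :: "nat \<Rightarrow> nat \<Rightarrow> nat" where "col w u = u mod w"

definition prog_vec :: "(nat \<Rightarrow> (nat \<Rightarrow> bit) \<Rightarrow> nat \<Rightarrow> bit) \<Rightarrow> nat \<Rightarrow> nat \<Rightarrow> nat \<Rightarrow> bit" where
  "prog_vec T w u = layer_vec T (block w u) (row w u) (col w u)"

text \<open>The long index is the finished coordinate \<open>col w u\<close> of the previous state.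
  In block 0 the empty list turns the equation into "value = 0"; \<open>prog_vec\<close> disregards
  this and keeps the inputs free, which is the freedom exploited above the gap.\<close>

definition prog_preds :: "(nat \<Rightarrow> (nat \<Rightarrow> bit) \<Rightarrow> nat \<Rightarrow> bit) \<Rightarrow> nat \<Rightarrow> nat \<Rightarrow> nat list" where
  "prog_preds T w u =
     (if block w u = 0 then []
      else (if col w u = 0 then [] else [u - 1]) @
           (if T (block w u) (unitv (row w u)) (col w u) = 1
            then [(block w u - 1) * (w * w) + col w u * w + (w - 1)] else []))"

lemma prog_vec_after_gap:
  assumes T: "\<And>t. 1 \<le> t \<Longrightarrow> t < h \<Longrightarrow> inj_linear w (T t)"
    and g: "1 \<le> g" "g < h" and w: "1 \<le> w"
    and B: "\<And>u. u \<in> B \<Longrightarrow> g < block w u \<and> block w u < h"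
  defines "\<mu> \<equiv> \<Sum>u\<in>B. rel_vec T g (block w u) (row w u) (col w u)"
  shows "\<mu> \<in> vecs w" and "sum (prog_vec T w) B = comp_from T 0 (g - 1) (T g \<mu>)"
proof -
  have L: "inj_linear w (comp_from T 0 (g - 1))"
    by (rule comp_from_inj_linear) (use g in \<open>auto intro!: T\<close>)
  have Tg: "inj_linear w (T g)" using T g by simp
  have r: "rel_vec T g (block w u) (row w u) (col w u) \<in> vecs w" if "u \<in> B" for u
    using B[OF that] w by (intro rel_vec_vecs T) (auto simp: row_def)
  show "\<mu> \<in> vecs w" unfolding \<mu>_def using r by (rule vecs_sum)
  have "comp_from T 0 (g - 1) (T g \<mu>)
      = comp_from T 0 (g - 1) (\<Sum>u\<in>B. T g (rel_vec T g (block w u) (row w u) (col w u)))"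
    unfolding \<mu>_def using inj_linear_sum[OF Tg r, of B "\<lambda>u. u"] by simp
  also have "\<dots> = (\<Sum>u\<in>B. comp_from T 0 (g - 1) (T g (rel_vec T g (block w u) (row w u) (col w u))))"
    using r by (intro inj_linear_sum[OF L] inj_linear_vecs[OF Tg])
  also have "\<dots> = sum (prog_vec T w) B"
    using B g by (intro sum.cong) (auto simp: prog_vec_def layer_vec_eq_rel_vec)
  finally show "sum (prog_vec T w) B = comp_from T 0 (g - 1) (T g \<mu>)" by simp
qed

text \<open>Composing the map at the gap with a transvection moves the image of the future to any
  prescribed nonzero vector, so each single coincidence has probability at most
  \<open>1 / (2 ^ w - 1)\<close>.\<close>

lemma card_coincidences_le:
  assumes g: "1 \<le> g" "g < h" and w: "1 \<le> w"
    and A: "\<And>u. u \<in> A \<Longrightarrow> block w u < g"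
    and B: "\<And>u. u \<in> B \<Longrightarrow> g < block w u \<and> block w u < h"
  defines "\<Omega> \<equiv> PiE {1..<h} (\<lambda>_. GL w)"
  defines "Bad \<equiv> {T \<in> \<Omega>. sum (prog_vec T w) A = sum (prog_vec T w) B \<and> sum (prog_vec T w) B \<noteq> 0}"
  shows "card Bad * (2 ^ w - 1) \<le> card \<Omega>"
proof -
  define \<gamma> where "\<gamma> x y = (SOME \<tau>. inj_linear w \<tau> \<and> \<tau> x = y)" for x y
  have \<gamma>: "inj_linear w (\<gamma> x y) \<and> \<gamma> x y x = y"
    if "x \<in> vecs w" "y \<in> vecs w" "x \<noteq> 0" "y \<noteq> 0" for x y
    using someI_ex[OF transvection_exists[OF that]] unfolding \<gamma>_def .
  define \<mu> where "\<mu> T = (\<Sum>u\<in>B. rel_vec T g (block w u) (row w u) (col w u))" for T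
  have lin: "inj_linear w (T t)" if "T \<in> \<Omega>" "1 \<le> t" "t < h" for T t
    using that by (auto simp: \<Omega>_def GL_def PiE_def Pi_def)
  have ext: "T t \<in> extensional (vecs w)" if "T \<in> \<Omega>" "1 \<le> t" "t < h" for T t
    using that by (auto simp: \<Omega>_def GL_def PiE_def Pi_def)
  have \<mu>W: "\<mu> T \<in> vecs w" and sumB: "sum (prog_vec T w) B = comp_from T 0 (g - 1) (T g (\<mu> T))"
    if "T \<in> \<Omega>" for T
    using prog_vec_after_gap[of h w T g B] lin[OF that] g w B by (auto simp: \<mu>_def)
  have L: "inj_linear w (comp_from T 0 (g - 1))" if "T \<in> \<Omega>" for T
    by (rule comp_from_inj_linear) (use g in \<open>auto intro!: lin[OF that]\<close>)
  have \<mu>0: "\<mu> T \<noteq> 0" if "T \<in> Bad" for T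
  proof
    assume "\<mu> T = 0"
    have T: "T \<in> \<Omega>" using that by (simp add: Bad_def)
    have "T g (\<mu> T) = 0" using \<open>\<mu> T = 0\<close> inj_linear_zero[OF lin[OF T g]] by simp
    then have "sum (prog_vec T w) B = 0" using sumB[OF T] inj_linear_zero[OF L[OF T]] by simp
    then show False using that by (simp add: Bad_def)
  qed
  define \<nu> where "\<nu> T = T g (\<mu> T)" for T
  have \<nu>W: "\<nu> T \<in> vecs w" if "T \<in> \<Omega>" for T
    unfolding \<nu>_def by (rule inj_linear_vecs[OF lin[OF that g] \<mu>W[OF that]])
  have \<nu>0: "\<nu> T \<noteq> 0" if "T \<in> Bad" for T
    unfolding \<nu>_def
    using inj_linear_nonzero[OF lin[OF _ g] \<mu>W \<mu>0[OF that]] that by (simp add: Bad_def)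
  \<comment> \<open>The map at the gap is traded for one that sends the future to y instead of
    \<open>\<nu> T\<close>. Since y ranges over all nonzero vectors, injectivity of this trade gives
    the factor \<open>2 ^ w - 1\<close>.\<close>
  define \<Phi> where "\<Phi> p = (fst p)(g := restrict (\<gamma> (\<nu> (fst p)) (snd p) \<circ> fst p g) (vecs w))" for p
  have cong\<mu>: "\<mu> T = \<mu> S" if "\<And>t. t \<noteq> g \<Longrightarrow> T t = S t" for T S
    unfolding \<mu>_def rel_vec_def
  proof (rule sum.cong)
    fix u assume "u \<in> B"
    then have "g < block w u" using B by blast
    then have "T (block w u) = S (block w u)" using that by auto
    moreover have "comp_from T g (block w u - 1 - g) = comp_from S g (block w u - 1 - g)"
      using that by (intro comp_from_cong) auto
    ultimately show "comp_from T g (block w u - 1 - g) (trunc (col w u) (T (block w u) (unitv (row w u))))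
      = comp_from S g (block w u - 1 - g) (trunc (col w u) (S (block w u) (unitv (row w u))))" by simp
  qed simp
  have congL: "comp_from T 0 n = comp_from S 0 n" if "\<And>t. t \<noteq> g \<Longrightarrow> T t = S t" "n < g" for T S n
    using that by (intro comp_from_cong) auto
  have congA: "sum (prog_vec T w) A = sum (prog_vec S w) A" if "\<And>t. t \<noteq> g \<Longrightarrow> T t = S t" for T S
  proof (rule sum.cong)
    fix u assume "u \<in> A"
    then have b: "block w u < g" using A by blast
    then have "T (block w u) = S (block w u)" using that by auto
    moreover have "comp_from T 0 (block w u - 1) = comp_from S 0 (block w u - 1)"
      using b by (intro congL that) auto
    ultimately show "prog_vec T w u = prog_vec S w u" by (simp add: prog_vec_def layer_vec_def)
  qed simp
  have into: "\<Phi> p \<in> \<Omega>" if "p \<in> Bad \<times> (vecs w - {0})" for p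
  proof -
    obtain T y where p: "p = (T, y)" "T \<in> Bad" "y \<in> vecs w" "y \<noteq> 0" using \<open>p \<in> _\<close> by auto
    have T: "T \<in> \<Omega>" using p by (simp add: Bad_def)
    have "inj_linear w (\<gamma> (\<nu> T) y)" using \<gamma> \<nu>W[OF T] \<nu>0 p by blast
    then have "restrict (\<gamma> (\<nu> T) y \<circ> T g) (vecs w) \<in> GL w"
      using lin[OF T g] by (intro inj_linear_restrict inj_linear_comp)
    then show ?thesis using T g p(1)
      by (auto simp: \<Phi>_def \<Omega>_def PiE_def Pi_def extensional_def)
  qed
  \<comment> \<open>The image shows all maps except the one at g, hence \<open>\<mu>\<close> and,
    through the coincidence with the sum over A, also \<open>\<nu>\<close>. The new map sends
    \<open>\<mu>\<close> to y; so y is known and the transvection can be cancelled.\<close>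
  have "inj_on \<Phi> (Bad \<times> (vecs w - {0}))"
  proof (rule inj_onI)
    fix p q assume pq: "p \<in> Bad \<times> (vecs w - {0})" "q \<in> Bad \<times> (vecs w - {0})" "\<Phi> p = \<Phi> q"
    obtain T y where p: "p = (T, y)" "T \<in> Bad" "y \<in> vecs w" "y \<noteq> 0" using pq by auto
    obtain S z where q: "q = (S, z)" "S \<in> Bad" "z \<in> vecs w" "z \<noteq> 0" using pq by auto
    have T: "T \<in> \<Omega>" and S: "S \<in> \<Omega>" using p q by (simp_all add: Bad_def)
    have off: "T t = S t" if "t \<noteq> g" for t
      using fun_cong[OF pq(3), of t] that by (simp add: \<Phi>_def p q)
    have at_g: "restrict (\<gamma> (\<nu> T) y \<circ> T g) (vecs w) = restrict (\<gamma> (\<nu> S) z \<circ> S g) (vecs w)"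
      using fun_cong[OF pq(3), of g] by (simp add: \<Phi>_def p q)
    have \<mu>eq: "\<mu> T = \<mu> S" using off by (rule cong\<mu>)
    have Leq: "comp_from T 0 (g - 1) = comp_from S 0 (g - 1)" using off g by (intro congL) auto
    have "comp_from T 0 (g - 1) (\<nu> T) = sum (prog_vec T w) A"
      using p(2) sumB[OF T] by (simp add: \<nu>_def Bad_def)
    also have "\<dots> = sum (prog_vec S w) A" using off by (rule congA)
    also have "\<dots> = comp_from T 0 (g - 1) (\<nu> S)"
      using q(2) sumB[OF S] Leq by (simp add: \<nu>_def Bad_def)
    finally have \<nu>eq: "\<nu> T = \<nu> S"
      by (rule inj_linear_eq[OF L[OF T] \<nu>W[OF T] \<nu>W[OF S]])
    have gT: "inj_linear w (\<gamma> (\<nu> T) y) \<and> \<gamma> (\<nu> T) y (\<nu> T) = y"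
      using \<gamma> \<nu>W[OF T] \<nu>0 p by blast
    have gS: "inj_linear w (\<gamma> (\<nu> S) z) \<and> \<gamma> (\<nu> S) z (\<nu> S) = z"
      using \<gamma> \<nu>W[OF S] \<nu>0 q by blast
    have yz: "y = z"
      using fun_cong[OF at_g, of "\<mu> T"] \<mu>W[OF T] \<mu>eq gT gS by (simp add: \<nu>_def)
    have "T g = S g"
    proof (rule extensionalityI[OF ext[OF T g] ext[OF S g]])
      fix x assume x: "x \<in> vecs w"
      have "\<gamma> (\<nu> T) y (T g x) = \<gamma> (\<nu> T) y (S g x)"
        using fun_cong[OF at_g, of x] x by (simp add: \<nu>eq yz)
      then show "T g x = S g x"
        using inj_linear_eq[of w "\<gamma> (\<nu> T) y"] gT
          inj_linear_vecs[OF lin[OF T g] x] inj_linear_vecs[OF lin[OF S g] x] by blast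
    qed
    then have "T = S" using off by (intro HOL.ext) (metis off)
    then show "p = q" using yz p q by simp
  qed
  moreover have "\<Phi> ` (Bad \<times> (vecs w - {0})) \<subseteq> \<Omega>" using into by blast
  moreover have "finite \<Omega>" unfolding \<Omega>_def by (intro finite_PiE finite_GL) auto
  ultimately have "card (Bad \<times> (vecs w - {0})) \<le> card \<Omega>" by (rule card_inj_on_le)
  moreover have "card (vecs w - {0}) = 2 ^ w - 1"
    using vecs_zero[of w] by (simp add: card_Diff_singleton card_vecs)
  ultimately show ?thesis by (simp add: card_cartesian_product)
qed

section \<open>Index arithmetic and the dependency graph of the computation\<close>

lemma index_coords:
  assumes "i < w" "j < w"
  shows "block w ((t * w + i) * w + j) = t" "row w ((t * w + i) * w + j) = i"
    "col w ((t * w + i) * w + j) = j"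
proof -
  have q: "((t * w + i) * w + j) div w = t * w + i" using assms by simp
  then show "block w ((t * w + i) * w + j) = t"
    using assms by (simp add: block_def div_mult2_eq)
  show "row w ((t * w + i) * w + j) = i" unfolding row_def q using assms by simp
  show "col w ((t * w + i) * w + j) = j" using assms by (simp add: col_def)
qed

lemma index_eq: "u = (block w u * w + row w u) * w + col w u"
  unfolding block_def row_def col_def div_mult2_eq by (simp add: div_mult_mod_eq)

lemma block_lt: "u < h * (w * w) \<Longrightarrow> block w u < h"
  by (simp add: block_def less_mult_imp_div_less)

lemma pred_coords:
  assumes "1 \<le> w" "col w u \<noteq> 0"
  shows "block w (u - 1) = block w u" "row w (u - 1) = row w u" "col w (u - 1) = col w u - 1"
proof -
  have r: "row w u < w" "col w u - 1 < w"
    using assms(1) by (auto simp: row_def col_def less_imp_diff_less)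
  have "u - 1 = (block w u * w + row w u) * w + (col w u - 1)"
    using index_eq[of u w] assms(2) by linarith
  then show "block w (u - 1) = block w u" "row w (u - 1) = row w u" "col w (u - 1) = col w u - 1"
    using index_coords[OF r, of "block w u"] by simp_all
qed

lemma layer_index_coords:
  assumes "1 \<le> w" "j < w"
  shows "block w (t * (w * w) + j * w + (w - 1)) = t" "row w (t * (w * w) + j * w + (w - 1)) = j"
    "col w (t * (w * w) + j * w + (w - 1)) = w - 1"
proof -
  have "t * (w * w) + j * w + (w - 1) = (t * w + j) * w + (w - 1)" by (simp add: algebra_simps)
  then show "block w (t * (w * w) + j * w + (w - 1)) = t"
    "row w (t * (w * w) + j * w + (w - 1)) = j" "col w (t * (w * w) + j * w + (w - 1)) = w - 1"
    using index_coords[OF assms(2), of "w - 1" t] assms(1) by simp_all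
qed

text \<open>Dependencies never skip a block, so no equation reaches across an untouched one.
  Decreasing indices make recursion over predecessors well-founded.\<close>

lemma prog_preds_less:
  assumes "1 \<le> w" "p \<in> set (prog_preds T w u)"
  shows "p < u" and "block w p = block w u \<or> Suc (block w p) = block w u"
proof -
  have c: "col w u < w" using assms(1) by (simp add: col_def)
  have "block w u \<noteq> 0" using assms(2) by (auto simp: prog_preds_def split: if_splits)
  consider "col w u \<noteq> 0" "p = u - 1"
    | "p = (block w u - 1) * (w * w) + col w u * w + (w - 1)"
    using assms(2) by (auto simp: prog_preds_def split: if_splits)
  then have "p < u \<and> (block w p = block w u \<or> Suc (block w p) = block w u)"
  proof cases
    case 1
    then have "u \<noteq> 0" by (cases u) (auto simp: col_def)
    then show ?thesis using 1 pred_coords[OF assms(1) 1(1)] by simp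
  next
    case 2
    have b: "block w p = block w u - 1" using layer_index_coords[OF assms(1) c] 2 by simp
    then have "block w p < block w u" using \<open>block w u \<noteq> 0\<close> by simp
    then have "p < u" unfolding block_def by (meson div_le_mono not_le)
    then show ?thesis using b \<open>block w u \<noteq> 0\<close> by simp
  qed
  then show "p < u" "block w p = block w u \<or> Suc (block w p) = block w u" by auto
qed

text \<open>The two predecessors lie in different blocks. Repeated entries would cancel over the
  two-element field; without them an equation is a sum over a set.\<close>

lemma prog_preds_distinct:
  assumes "1 \<le> w"
  shows "distinct (u # prog_preds T w u)" "length (prog_preds T w u) \<le> 2"
proof -
  have "u \<notin> set (prog_preds T w u)" using prog_preds_less(1)[OF assms] by blast
  moreover have "u - 1 \<noteq> (block w u - 1) * (w * w) + col w u * w + (w - 1)"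
    if "block w u \<noteq> 0" "col w u \<noteq> 0"
  proof
    assume e: "u - 1 = (block w u - 1) * (w * w) + col w u * w + (w - 1)"
    have "block w u = block w u - 1"
      using layer_index_coords(1)[OF assms, of "col w u" "block w u - 1"] e pred_coords(1)[OF assms that(2)]
        assms by (simp add: col_def)
    then show False using that(1) by simp
  qed
  ultimately show "distinct (u # prog_preds T w u)" by (auto simp: prog_preds_def)
  show "length (prog_preds T w u) \<le> 2" by (simp add: prog_preds_def)
qed

lemma prog_vec_step:
  assumes T: "\<And>t. 1 \<le> t \<Longrightarrow> t < h \<Longrightarrow> inj_linear w (T t)"
    and w: "1 \<le> w" and u: "u < h * (w * w)" "1 \<le> block w u"
  shows "prog_vec T w u = (\<Sum>p\<in>set (prog_preds T w u). prog_vec T w p)"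
proof -
  have c: "col w u < w" "row w u < w" using w by (simp_all add: col_def row_def)
  let ?x = "(block w u - 1) * (w * w) + col w u * w + (w - 1)"
  have x: "prog_vec T w ?x = layer_vec T (block w u - 1) (col w u) (w - 1)"
    unfolding prog_vec_def using layer_index_coords[OF w c(1)] by simp
  have p: "prog_vec T w (u - 1) = layer_vec T (block w u) (row w u) (col w u - 1)" if "col w u \<noteq> 0"
    unfolding prog_vec_def using pred_coords[OF w that] by simp
  have "prog_vec T w u = (if col w u = 0 then 0 else prog_vec T w (u - 1))
     + (if T (block w u) (unitv (row w u)) (col w u) = 1 then prog_vec T w ?x else 0)"
    unfolding x using layer_vec_step[of "block w u" w T "row w u" "col w u"] T block_lt[OF u(1)] u(2) c p
    by (simp add: prog_vec_def[of T w u])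
  also have "\<dots> = sum_list (map (prog_vec T w) (prog_preds T w u))"
    using u(2) by (simp add: prog_preds_def)
  also have "\<dots> = (\<Sum>p\<in>set (prog_preds T w u). prog_vec T w p)"
    using prog_preds_distinct(1)[OF w, where T = T and u = u] by (simp add: sum_list_distinct_conv_sum_set)
  finally show ?thesis .
qed

text \<open>The last index lies in column \<open>w - 1\<close>, so it is a full coordinate of the
  final state and not a proper prefix sum, which could vanish.\<close>

lemma prog_vec_last_nonzero:
  assumes T: "\<And>t. 1 \<le> t \<Longrightarrow> t < h \<Longrightarrow> inj_linear w (T t)"
    and w: "1 \<le> w" and h: "2 \<le> h"
  shows "prog_vec T w (h * (w * w) - 1) \<noteq> 0" and "block w (h * (w * w) - 1) = h - 1"
proof -
  have "h * (w * w) = (h - 1) * (w * w) + w * w" using h by (cases h) auto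
  moreover have "w * w = (w - 1) * w + w" using w by (cases w) auto
  ultimately have e: "h * (w * w) - 1 = (h - 1) * (w * w) + (w - 1) * w + (w - 1)"
    using w by linarith
  have w1: "w - 1 < w" using w by simp
  note co = layer_index_coords[OF w w1, of "h - 1", folded e]
  show "block w (h * (w * w) - 1) = h - 1" by (rule co(1))
  have h1: "1 \<le> h - 1" "h - 1 < h" using h by auto
  have L: "inj_linear w (comp_from T 0 (h - 1 - 1))"
    by (rule comp_from_inj_linear) (auto intro!: T)
  have z: "T (h - 1) (unitv (w - 1)) \<in> vecs w"
    by (intro inj_linear_vecs[OF T] h1 vecs_unitv w1)
  moreover have "T (h - 1) (unitv (w - 1)) \<noteq> 0"
    by (intro inj_linear_nonzero[OF T] h1 vecs_unitv w1 unitv_nonzero)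
  ultimately have "comp_from T 0 (h - 1 - 1) (T (h - 1) (unitv (w - 1))) \<noteq> 0"
    by (rule inj_linear_nonzero[OF L])
  then show "prog_vec T w (h * (w * w) - 1) \<noteq> 0"
    unfolding prog_vec_def co layer_vec_def using h1 trunc_full[OF z] by (simp add: unitv_nonzero)
qed

text \<open>One choice of maps must serve every gap, so the union bound runs over g as well. The
  size \<open>d + 1\<close> on the upper side leaves room for the last value next to d
  others.\<close>

lemma generic_maps_exist:
  assumes w: "1 \<le> w"
    and bound: "h * (h * (w * w)) ^ (2 * d + 1) + 1 < 2 ^ w"
  obtains T where "\<And>t. 1 \<le> t \<Longrightarrow> t < h \<Longrightarrow> inj_linear w (T t)"
    and "\<And>g A B. 1 \<le> g \<Longrightarrow> A \<subseteq> {..<h * (w * w)} \<Longrightarrow> B \<subseteq> {..<h * (w * w)} \<Longrightarrow>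
       (\<And>u. u \<in> A \<Longrightarrow> block w u < g) \<Longrightarrow> (\<And>u. u \<in> B \<Longrightarrow> g < block w u) \<Longrightarrow>
       card A \<le> d \<Longrightarrow> card B \<le> d + 1 \<Longrightarrow>
       sum (prog_vec T w) A = sum (prog_vec T w) B \<Longrightarrow> sum (prog_vec T w) B = 0"
proof -
  define M where "M = h * (w * w)"
  define \<Omega> where "\<Omega> = PiE {1..<h} (\<lambda>_. GL w)"
  define XS where "XS l = {xs. set xs \<subseteq> {..<M} \<and> length xs = l}" for l
  define E where "E = {1..<h} \<times> XS d \<times> XS (d + 1)"
  \<comment> \<open>Pairs that do not straddle the gap get an empty \<open>Bad\<close>, so that the
    union bound may range over all pairs of lists.\<close>
  define ok where "ok g A B \<longleftrightarrow> (\<forall>u\<in>A. block w u < g) \<and> (\<forall>u\<in>B. g < block w u \<and> block w u < h)"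
    for g A B
  define Bad where "Bad g A B = {T \<in> \<Omega>. ok g A B \<and>
      (sum (prog_vec T w) A = sum (prog_vec T w) B \<and> sum (prog_vec T w) B \<noteq> 0)}" for g A B
  define Bad' where "Bad' q = Bad (fst q) (set (fst (snd q))) (set (snd (snd q)))"
    for q :: "nat \<times> nat list \<times> nat list"
  define N :: nat where "N = 2 ^ w - 1"
  have finXS: "finite (XS l)" and cXS: "card (XS l) = M ^ l" for l
    using finite_lists_length_eq[of "{..<M}" l] card_lists_length_eq[of "{..<M}" l]
    by (simp_all add: XS_def)
  have finE: "finite E" using finXS by (simp add: E_def)
  have "card E = (h - 1) * (M ^ d * M ^ (d + 1))"
    by (simp only: E_def card_cartesian_product cXS card_atLeastLessThan)
  also have "\<dots> = (h - 1) * M ^ (2 * d + 1)"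
    by (simp flip: power_add add: mult_2)
  also have "\<dots> \<le> h * M ^ (2 * d + 1)" by simp
  finally have cE: "card E < N" using bound by (simp add: N_def M_def)
  have fin\<Omega>: "finite \<Omega>" unfolding \<Omega>_def by (intro finite_PiE finite_GL) auto
  have "\<Omega> \<noteq> {}" unfolding \<Omega>_def using GL_nonempty by (simp add: PiE_eq_empty_iff)
  then have pos: "card \<Omega> > 0" using fin\<Omega> by (simp add: card_gt_0_iff)
  have le: "card (Bad' q) * N \<le> card \<Omega>" if "q \<in> E" for q
  proof (cases "ok (fst q) (set (fst (snd q))) (set (snd (snd q)))")
    case True
    moreover have "1 \<le> fst q" "fst q < h" using that by (auto simp: E_def)
    ultimately show ?thesis
      using card_coincidences_le[of "fst q" h w "set (fst (snd q))" "set (snd (snd q))"] w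
      by (simp add: Bad'_def Bad_def \<Omega>_def N_def ok_def)
  qed (simp add: Bad'_def Bad_def)
  have "card (\<Union>q\<in>E. Bad' q) * N \<le> (\<Sum>q\<in>E. card (Bad' q)) * N"
    by (intro mult_right_mono card_UN_le finE) auto
  also have "\<dots> = (\<Sum>q\<in>E. card (Bad' q) * N)" by (simp add: sum_distrib_right)
  also have "\<dots> \<le> (\<Sum>q\<in>E. card \<Omega>)" using le by (rule sum_mono)
  also have "\<dots> = card E * card \<Omega>" by simp
  also have "\<dots> < N * card \<Omega>" using cE pos by simp
  finally have lt: "card (\<Union>q\<in>E. Bad' q) < card \<Omega>" by (simp add: mult.commute)
  have "\<not> \<Omega> \<subseteq> (\<Union>q\<in>E. Bad' q)"
  proof
    assume "\<Omega> \<subseteq> (\<Union>q\<in>E. Bad' q)"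
    moreover have "(\<Union>q\<in>E. Bad' q) \<subseteq> \<Omega>" by (auto simp: Bad'_def Bad_def)
    ultimately show False using lt by (metis less_irrefl subset_antisym)
  qed
  then obtain T where T: "T \<in> \<Omega>" "\<And>q. q \<in> E \<Longrightarrow> T \<notin> Bad' q" by blast
  have lin: "inj_linear w (T t)" if "1 \<le> t" "t < h" for t
    using that T(1) by (auto simp: \<Omega>_def GL_def PiE_def Pi_def)
  show ?thesis
  proof (rule that[OF lin])
    fix g A B
    assume g: "1 \<le> g" and AB: "A \<subseteq> {..<h * (w * w)}" "B \<subseteq> {..<h * (w * w)}"
      and A: "\<And>u. u \<in> A \<Longrightarrow> block w u < g" and B: "\<And>u. u \<in> B \<Longrightarrow> g < block w u"
      and card: "card A \<le> d" "card B \<le> d + 1"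
      and eq: "sum (prog_vec T w) A = sum (prog_vec T w) B"
    have fin: "finite A" "finite B" using AB finite_subset by blast+
    show "sum (prog_vec T w) B = 0"
    proof (cases "A = {} \<or> B = {}")
      case True
      then show ?thesis using eq by auto
    next
      case False
      obtain xs where xs: "set xs = A" "length xs = d"
        using set_as_list_of_length[of A d] fin card False by blast
      obtain ys where ys: "set ys = B" "length ys = d + 1"
        using set_as_list_of_length[of B "d + 1"] fin card False by blast
      have Bh: "block w u < h" if "u \<in> B" for u using that AB block_lt by blast
      obtain b where "b \<in> B" using False by blast
      then have "g < h" using B[of b] Bh[of b] by simp
      then have "(g, xs, ys) \<in> E" using xs ys AB g by (simp add: E_def XS_def M_def)
      then have "T \<notin> Bad g A B" using T(2)[of "(g, xs, ys)"] xs ys by (simp add: Bad'_def)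
      then show ?thesis using T(1) eq A B Bh by (auto simp: Bad_def ok_def)
    qed
  qed
qed

section \<open>The pebble game\<close>

lemma sum_sym_diff_char2:
  fixes F :: "'a \<Rightarrow> 'b::comm_monoid_add"
  assumes fin: "finite A" "finite B" and char2: "\<And>x::'b. x + x = 0"
  shows "sum F ((A - B) \<union> (B - A)) = sum F A + sum F B"
proof -
  have "sum F A = sum F (A \<inter> B) + sum F (A - B)" by (rule sum.Int_Diff[OF fin(1)])
  moreover have "sum F B = sum F (A \<inter> B) + sum F (B - A)"
    using sum.Int_Diff[OF fin(2), of F A] by (simp add: Int_commute)
  moreover have "sum F ((A - B) \<union> (B - A)) = sum F (A - B) + sum F (B - A)"
    by (rule sum.union_disjoint) (use fin in auto)
  ultimately have "sum F A + sum F B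
      = (sum F (A \<inter> B) + sum F (A \<inter> B)) + sum F ((A - B) \<union> (B - A))" by (simp add: add_ac)
  then show ?thesis by (simp add: char2)
qed

text \<open>Collects what the game uses of the random choices. \<open>f\<close> gives the values as
  linear forms in the initial state and satisfies the equations above block 0 only, because the
  inputs count as free.\<close>

locale compressed_program =
  fixes n d D M :: nat and \<gamma> :: "nat \<Rightarrow> nat \<Rightarrow> nat" and preds :: "nat \<Rightarrow> nat list"
    and blk :: "nat \<Rightarrow> nat" and f :: "nat \<Rightarrow> nat \<Rightarrow> bit" and top :: nat
  assumes D: "1 \<le> D" and d: "3 \<le> d"
    and \<gamma>_less: "\<And>u i. u < M \<Longrightarrow> i < D \<Longrightarrow> \<gamma> u i < n div 2"
    and expand: "\<And>A. A \<subseteq> {..<M} \<Longrightarrow> card A \<le> 2 * d \<Longrightarrow> card A \<le> card (unique_nbrs \<gamma> D A)"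
    and preds_less: "\<And>u p. u < M \<Longrightarrow> p \<in> set (preds u) \<Longrightarrow> p < u"
    and preds_distinct: "\<And>u. u < M \<Longrightarrow> distinct (u # preds u)"
    and preds_length: "\<And>u. u < M \<Longrightarrow> length (preds u) \<le> 2"
    and preds_blk: "\<And>u p. u < M \<Longrightarrow> p \<in> set (preds u) \<Longrightarrow> blk p = blk u \<or> Suc (blk p) = blk u"
    and blk_mono: "\<And>u p. p \<le> u \<Longrightarrow> blk p \<le> blk u"
    and f_step: "\<And>u. u < M \<Longrightarrow> 1 \<le> blk u \<Longrightarrow> f u = sum f (set (preds u))"
    and gap: "\<And>g A B. 1 \<le> g \<Longrightarrow> A \<subseteq> {..<M} \<Longrightarrow> B \<subseteq> {..<M} \<Longrightarrow>
       (\<And>u. u \<in> A \<Longrightarrow> blk u < g) \<Longrightarrow> (\<And>u. u \<in> B \<Longrightarrow> g < blk u) \<Longrightarrow>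
       card A \<le> d \<Longrightarrow> card B \<le> d + 1 \<Longrightarrow> sum f A = sum f B \<Longrightarrow> sum f B = 0"
    and top_less: "top < M" and f_top: "f top \<noteq> 0"
begin

text \<open>\<open>determined Q\<close> consists of the small sets of values whose sum depends on variables in \<open>Q\<close>
  only.\<close>

definition val :: "(nat \<Rightarrow> bit) \<Rightarrow> nat set \<Rightarrow> bit" where
  "val \<beta> A = (\<Sum>u\<in>A. \<Sum>i<D. \<beta> (\<gamma> u i))"

definition parity :: "nat set \<Rightarrow> nat \<Rightarrow> bit" where
  "parity A v = val (\<lambda>x. of_bool (x = v)) A"

definition determined :: "nat set \<Rightarrow> nat set set" where
  "determined Q = {A. A \<subseteq> {..<M} \<and> card A \<le> d \<and> (\<forall>v. parity A v = 1 \<longrightarrow> v \<in> Q)}"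

definition closure :: "nat set \<Rightarrow> nat set" where
  "closure Q = \<Union> (determined Q)"

text \<open>The scalar multiple of \<open>f top\<close> by s. Values whose forms add up to it must
  total s once the last value is claimed to be 1.\<close>

definition scaled_top :: "bit \<Rightarrow> nat \<Rightarrow> bit" where
  "scaled_top s = (if s = 1 then f top else 0)"

text \<open>The flips \<open>\<beta>\<close> on the pebbled variables \<open>Q\<close> look as if all blocks below the
  pebble-free block \<open>g\<close> were computed from the true inputs, while all blocks above \<open>g\<close> were
  computed from unconstrained inputs subject only to the last value being \<open>1\<close>.\<close>

definition good :: "nat \<Rightarrow> nat set \<Rightarrow> (nat \<Rightarrow> bit) \<Rightarrow> bool" where
  "good g Q \<beta> \<longleftrightarrow> (\<forall>u\<in>closure Q. blk u \<noteq> g) \<and> (\<forall>v. n div 2 \<le> v \<longrightarrow> \<beta> v = 0) \<and>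
     (\<forall>A\<in>determined Q. \<forall>s. sum f {u \<in> A. g < blk u} = scaled_top s \<longrightarrow> val \<beta> A = s)"

section \<open>Sums determined by the pebbled variables\<close>

lemma finite_sub: "A \<subseteq> {..<M} \<Longrightarrow> finite A"
  using finite_subset by blast

lemma determinedD: "A \<in> determined Q \<Longrightarrow> A \<subseteq> {..<M} \<and> card A \<le> d \<and> finite A"
  by (auto simp: determined_def intro: finite_sub)

lemma determined_mono: "Q \<subseteq> Q' \<Longrightarrow> determined Q \<subseteq> determined Q'"
  by (auto simp: determined_def)

lemma closure_mono: "Q \<subseteq> Q' \<Longrightarrow> closure Q \<subseteq> closure Q'"
  unfolding closure_def using determined_mono by blast

lemma good_antimono: "good g Q' \<beta> \<Longrightarrow> Q \<subseteq> Q' \<Longrightarrow> good g Q \<beta>"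
  using determined_mono[of Q Q'] closure_mono[of Q Q'] unfolding good_def by blast

lemma val_sym_diff:
  "finite A \<Longrightarrow> finite B \<Longrightarrow> val \<beta> ((A - B) \<union> (B - A)) = val \<beta> A + val \<beta> B"
  unfolding val_def by (rule sum_sym_diff_char2) (auto simp: bit_add_self)

lemma parity_sym_diff:
  "finite A \<Longrightarrow> finite B \<Longrightarrow> parity ((A - B) \<union> (B - A)) v = parity A v + parity B v"
  unfolding parity_def by (rule val_sym_diff)

lemma parity_oneD:
  assumes "parity A v = 1"
  shows "\<exists>u\<in>A. \<exists>i<D. \<gamma> u i = v"
proof (rule ccontr)
  assume "\<not> ?thesis"
  then have "parity A v = 0" unfolding parity_def val_def by (intro sum.neutral) auto
  then show False using assms by simp
qed

lemma val_eq_sum_parity: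
  assumes "A \<subseteq> {..<M}"
  shows "val \<beta> A = (\<Sum>v<n div 2. parity A v * \<beta> v)"
proof -
  have "val \<beta> A = (\<Sum>u\<in>A. \<Sum>i<D. \<Sum>v<n div 2. of_bool (\<gamma> u i = v) * \<beta> v)"
    unfolding val_def
  proof (intro sum.cong refl)
    fix u i assume "u \<in> A" "i \<in> {..<D}"
    then have "\<gamma> u i < n div 2" using \<gamma>_less assms by blast
    then have "\<beta> (\<gamma> u i) = (\<Sum>v<n div 2. if \<gamma> u i = v then \<beta> v else 0)"
      by (simp only: sum.delta' finite_lessThan lessThan_iff if_True)
    also have "\<dots> = (\<Sum>v<n div 2. of_bool (\<gamma> u i = v) * \<beta> v)"
      by (intro sum.cong) auto
    finally show "\<beta> (\<gamma> u i) = (\<Sum>v<n div 2. of_bool (\<gamma> u i = v) * \<beta> v)" .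
  qed
  also have "\<dots> = (\<Sum>u\<in>A. \<Sum>v<n div 2. \<Sum>i<D. of_bool (\<gamma> u i = v) * \<beta> v)"
    by (intro sum.cong refl sum.swap)
  also have "\<dots> = (\<Sum>v<n div 2. \<Sum>u\<in>A. \<Sum>i<D. of_bool (\<gamma> u i = v) * \<beta> v)"
    by (rule sum.swap)
  also have "\<dots> = (\<Sum>v<n div 2. parity A v * \<beta> v)"
    by (simp only: parity_def val_def sum_distrib_right)
  finally show ?thesis .
qed

lemma val_cong:
  assumes "A \<in> determined Q" "\<And>v. v \<in> Q \<Longrightarrow> \<beta> v = \<beta>' v"
  shows "val \<beta> A = val \<beta>' A"
proof -
  have A: "A \<subseteq> {..<M}" using determinedD[OF assms(1)] by blast
  have "parity A v * \<beta> v = parity A v * \<beta>' v" for v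
    using assms by (cases "parity A v") (auto simp: determined_def)
  then show ?thesis by (simp add: val_eq_sum_parity[OF A])
qed

lemma val_fun_upd: "val (\<beta>(v := b)) A = val (\<beta>(v := 0)) A + parity A v * b"
proof -
  have "(\<beta>(v := b)) x = (\<beta>(v := 0)) x + of_bool (x = v) * b" for x by simp
  then show ?thesis
    unfolding val_def parity_def by (simp only: sum.distrib sum_distrib_right)
qed

lemma parity_eq_card_hits:
  assumes "finite A" shows "parity A v = of_nat (card (hits \<gamma> D A v))"
proof -
  have "card (hits \<gamma> D A v) = (\<Sum>p\<in>A \<times> {..<D}. of_bool (\<gamma> (fst p) (snd p) = v))"
    using assms unfolding hits_def by (simp add: sum_of_bool_eq Int_def)
  also have "\<dots> = (\<Sum>u\<in>A. \<Sum>i<D. of_bool (\<gamma> u i = v))"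
    by (simp only: sum.cartesian_product split_def)
  finally show ?thesis by (simp add: parity_def val_def)
qed

text \<open>A variable met once by the union is met once by any member containing the value
  responsible, so it has parity 1 there and must lie in Q.\<close>

lemma unique_nbrs_Union_subset:
  assumes "\<F> \<subseteq> determined Q"
  shows "unique_nbrs \<gamma> D (\<Union>\<F>) \<subseteq> Q"
proof
  fix v assume "v \<in> unique_nbrs \<gamma> D (\<Union>\<F>)"
  then obtain p where p: "hits \<gamma> D (\<Union>\<F>) v = {p}"
    unfolding unique_nbrs_def using card_1_singletonE[of "hits \<gamma> D (\<Union>\<F>) v"] by auto
  then have "p \<in> hits \<gamma> D (\<Union>\<F>) v" by simp
  then obtain A where A: "A \<in> \<F>" "p \<in> hits \<gamma> D A v" by (auto simp: hits_def)
  moreover have "hits \<gamma> D A v \<subseteq> {p}" using p A(1) by (auto simp: hits_def)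
  ultimately have "hits \<gamma> D A v = {p}" by blast
  have AQ: "A \<in> determined Q" using A assms by blast
  have "finite A" using determinedD[OF AQ] by blast
  then have "parity A v = 1" using \<open>hits \<gamma> D A v = {p}\<close> by (simp add: parity_eq_card_hits)
  then show "v \<in> Q" using AQ by (simp add: determined_def)
qed

lemma finite_determined: "finite (determined Q)"
  by (rule finite_subset[of _ "Pow {..<M}"]) (auto simp: determined_def)

text \<open>Determined sets are joined one at a time. Each new union has at most
  \<open>d + d\<close> elements, so expansion applies; its unique neighbours lie in Q, which brings
  the size back to at most d.\<close>

lemma card_closure:
  assumes "finite Q" "card Q \<le> d"
  shows "card (closure Q) \<le> d" "closure Q \<subseteq> {..<M}"
proof -
  show "closure Q \<subseteq> {..<M}" by (auto simp: closure_def determined_def)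
  have "\<F> \<subseteq> determined Q \<Longrightarrow> card (\<Union>\<F>) \<le> d" if "finite \<F>" for \<F>
    using that
  proof (induction \<F>)
    case (insert A \<F>)
    have sub: "\<Union>(insert A \<F>) \<subseteq> {..<M}"
      using insert.prems by (auto simp: determined_def)
    have "card (\<Union>(insert A \<F>)) \<le> card A + card (\<Union>\<F>)"
      using card_Un_le[of A "\<Union>\<F>"] by simp
    also have "\<dots> \<le> 2 * d"
      using insert determinedD[of A Q] by auto
    finally have "card (\<Union>(insert A \<F>)) \<le> card (unique_nbrs \<gamma> D (\<Union>(insert A \<F>)))"
      by (rule expand[OF sub])
    also have "\<dots> \<le> card Q"
      by (rule card_mono[OF assms(1) unique_nbrs_Union_subset[OF insert.prems]])
    finally show ?case using assms(2) by simp
  qed simp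
  then show "card (closure Q) \<le> d"
    unfolding closure_def using finite_determined by blast
qed

text \<open>The size bound is the point: it survives because both sets live in the closure. Thus the
  determined sets form a vector space over the two-element field.\<close>

lemma determined_sym_diff:
  assumes "finite Q" "card Q \<le> d" "A \<in> determined Q" "B \<in> determined Q"
  shows "(A - B) \<union> (B - A) \<in> determined Q"
proof -
  let ?C = "(A - B) \<union> (B - A)"
  have C: "?C \<subseteq> closure Q" using assms(3,4) by (auto simp: closure_def)
  have "card ?C \<le> card (closure Q)"
    using C card_closure(2)[OF assms(1,2)] by (intro card_mono finite_sub)
  also have "\<dots> \<le> d" by (rule card_closure(1)[OF assms(1,2)])
  finally have "card ?C \<le> d" .
  moreover have "?C \<subseteq> {..<M}" using C card_closure(2)[OF assms(1,2)] by blast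
  moreover have "v \<in> Q" if "parity ?C v = 1" for v
  proof -
    have "parity A v + parity B v = 1"
      using that parity_sym_diff[of A B v] determinedD[OF assms(3)] determinedD[OF assms(4)] by simp
    then have "parity A v = 1 \<or> parity B v = 1" by (cases "parity A v") auto
    then show ?thesis using assms(3,4) by (auto simp: determined_def)
  qed
  ultimately show ?thesis by (simp add: determined_def)
qed

section \<open>Maintaining the invariant in one round\<close>

lemma scaled_top_add: "scaled_top s + scaled_top t = scaled_top (s + t)"
  by (cases s; cases t) (simp_all add: scaled_top_def vec_add_self)

lemma scaled_top_eq: "scaled_top s = 0 \<Longrightarrow> s = 0"
  using f_top by (cases s) (auto simp: scaled_top_def)

lemma vec_add_eq_iff: "(x::nat \<Rightarrow> bit) + y = z \<longleftrightarrow> x = z + y"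
proof -
  have "x + y + y = x" "z + y + y = z" by (simp_all only: add.assoc vec_add_self add_0_right)
  then show ?thesis by auto
qed

text \<open>Lowering the gap creates no new constraint on the old pebbles. Otherwise the values
  strictly between g' and g would share a nonzero sum with those above g, the last value possibly
  added. That is a coincidence across block g, excluded by \<open>gap\<close>; so the part above g
  alone sums to \<open>scaled_top s\<close>, and the invariant at g applies.\<close>

lemma good_lower_gap:
  assumes good: "good g Q \<beta>" and g: "1 \<le> g" "g' < g" "g < blk top"
    and free: "\<forall>u\<in>closure Q. blk u \<noteq> g'"
    and A: "A \<in> determined Q" and eq: "sum f {u \<in> A. g' < blk u} = scaled_top s"
  shows "val \<beta> A = s"
proof -
  let ?A1 = "{u \<in> A. g' < blk u \<and> blk u < g}" and ?A2 = "{u \<in> A. g < blk u}"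
  let ?T = "if s = 1 then {top} else {}"
  \<comment> \<open>The symmetric difference adds the last value correctly even if A already
    contains it.\<close>
  let ?B = "(?A2 - ?T) \<union> (?T - ?A2)"
  note AD = determinedD[OF A]
  have "blk u \<noteq> g" if "u \<in> A" for u
    using good A that by (auto simp: good_def closure_def)
  then have split: "{u \<in> A. g' < blk u} = ?A1 \<union> ?A2"
    using g(2) by (auto simp: nat_neq_iff)
  have "sum f ?A1 + sum f ?A2 = scaled_top s"
    unfolding eq[symmetric] split by (rule sum.union_disjoint[symmetric]) (use AD in auto)
  then have e1: "sum f ?A1 = scaled_top s + sum f ?A2" by (rule iffD1[OF vec_add_eq_iff])
  have "sum f ?B = sum f ?A2 + sum f ?T"
    by (rule sum_sym_diff_char2) (use AD in \<open>auto simp: vec_add_self\<close>)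
  then have e2: "sum f ?B = scaled_top s + sum f ?A2"
    by (simp add: scaled_top_def add.commute)
  have "card ?A1 \<le> card A" "card ?A2 \<le> card A" using AD by (auto intro!: card_mono)
  moreover have "card ?B \<le> card ?A2 + card ?T"
  proof (rule order_trans[OF card_Un_le], rule add_mono)
    show "card (?A2 - ?T) \<le> card ?A2" using AD by (intro card_mono) auto
    show "card (?T - ?A2) \<le> card ?T" by (intro card_mono) auto
  qed
  ultimately have "card ?A1 \<le> d" "card ?B \<le> d + 1" using AD by (auto split: if_splits)
  then have "sum f ?B = 0"
    by (intro gap[OF g(1), of ?A1 ?B]) (use AD e1 e2 g(3) top_less in \<open>auto split: if_splits\<close>)
  then have "sum f ?A2 = scaled_top s"
    using e2 vec_add_eq_iff[of "scaled_top s" "sum f ?A2" 0] by simp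
  then show ?thesis using good A by (auto simp: good_def)
qed

text \<open>Of the \<open>d + 1\<close> blocks directly below g, the at most d values of the closure
  miss one, which becomes the new gap. The new flip is consistent because two sets forcing it differ
  by a set in which v cancels, and that set already obeys the invariant. By
  \<open>d + 2 \<le> g\<close> the new gap is at least 1.\<close>

lemma good_extend:
  assumes good: "good g Q \<beta>" and Q: "finite Q" "card (insert v Q) \<le> d"
    and g: "d + 2 \<le> g" "g < blk top"
  shows "\<exists>b g'. g \<le> g' + (d + 1) \<and> g' < g \<and> good g' (insert v Q) (\<beta>(v := b)) \<and>
    (v \<in> Q \<longrightarrow> b = \<beta> v)"
proof -
  let ?Q = "insert v Q"
  have finQ: "finite ?Q" using Q by simp
  note cl = card_closure[OF finQ Q(2)]
  have cQ: "card Q \<le> d" using Q card_insert_le[of Q v] by linarith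
  have "\<not> {g - (d + 1)..<g} \<subseteq> blk ` closure ?Q"
  proof
    assume "{g - (d + 1)..<g} \<subseteq> blk ` closure ?Q"
    then have "card {g - (d + 1)..<g} \<le> card (blk ` closure ?Q)"
      using finite_sub[OF cl(2)] by (intro card_mono) auto
    also have "\<dots> \<le> d" using card_image_le[OF finite_sub[OF cl(2)], of blk] cl(1) by linarith
    finally show False using g(1) by simp
  qed
  then obtain g' where "g' \<in> {g - (d + 1)..<g}" "g' \<notin> blk ` closure ?Q" by blast
  then have g': "g \<le> g' + (d + 1)" "g' < g" "\<forall>u\<in>closure ?Q. blk u \<noteq> g'" by auto
  have free: "\<forall>u\<in>closure Q. blk u \<noteq> g'" using g'(3) closure_mono[of Q ?Q] by blast
  have old: "val \<beta> A = s" if "A \<in> determined Q" "sum f {u \<in> A. g' < blk u} = scaled_top s" for A s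
    by (rule good_lower_gap[OF good _ g'(2) g(2) free that]) (use g in simp)
  define forced where "forced A s \<longleftrightarrow> A \<in> determined ?Q \<and> parity A v = 1 \<and>
      sum f {u \<in> A. g' < blk u} = scaled_top s" for A s
  show ?thesis
  proof (cases "v \<in> Q")
    case True
    then have "?Q = Q" by auto
    then have "good g' ?Q \<beta>" using old free good by (auto simp: good_def)
    then show ?thesis using g' by (intro exI[of _ "\<beta> v"] exI[of _ g']) simp
  next
    case False
    \<comment> \<open>Any forcing set may be used to read off the flip. The default 0 also covers
      the padding index, which occurs in no equation.\<close>
    define b where "b = (if \<exists>A s. forced A s
        then (let q = (SOME q. forced (fst q) (snd q)) in snd q + val (\<beta>(v := 0)) (fst q)) else 0)"
    have v: "v < n div 2" if "forced A s" for A s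
    proof -
      have "A \<subseteq> {..<M}" "parity A v = 1" using that determinedD by (auto simp: forced_def)
      then show ?thesis using parity_oneD[of A v] \<gamma>_less by blast
    qed
    have b: "val (\<beta>(v := b)) A = s" if A: "forced A s" for A s
    proof -
      define q where "q = (SOME q. forced (fst q) (snd q))"
      have "forced (fst (A, s)) (snd (A, s))" using A by simp
      then have q: "forced (fst q) (snd q)" unfolding q_def by (rule someI)
      have bq: "b = snd q + val (\<beta>(v := 0)) (fst q)"
        using A by (auto simp: b_def q_def Let_def)
      let ?B = "fst q" and ?t = "snd q"
      let ?C = "(A - ?B) \<union> (?B - A)"
      have fin: "finite A" "finite ?B" using A q determinedD by (auto simp: forced_def)
      have C: "?C \<in> determined ?Q"
        using determined_sym_diff[OF finQ Q(2)] A q by (simp add: forced_def)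
      have "parity ?C v = 0" using parity_sym_diff[OF fin] A q by (simp add: forced_def)
      then have CQ: "?C \<in> determined Q" using C by (auto simp: determined_def)
      have "{u \<in> ?C. g' < blk u} = ({u \<in> A. g' < blk u} - {u \<in> ?B. g' < blk u})
          \<union> ({u \<in> ?B. g' < blk u} - {u \<in> A. g' < blk u})" by auto
      then have "sum f {u \<in> ?C. g' < blk u} = sum f {u \<in> A. g' < blk u} + sum f {u \<in> ?B. g' < blk u}"
        using fin by (simp only:) (rule sum_sym_diff_char2, auto simp: vec_add_self)
      also have "\<dots> = scaled_top (s + ?t)" using A q by (simp only: forced_def scaled_top_add)
      finally have "val \<beta> ?C = s + ?t" by (rule old[OF CQ])
      moreover have "val \<beta> ?C = val (\<beta>(v := 0)) ?C"
        using False by (intro val_cong[OF CQ]) auto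
      ultimately have "val (\<beta>(v := 0)) A + val (\<beta>(v := 0)) ?B = s + ?t"
        using val_sym_diff[OF fin] by simp
      moreover have "val (\<beta>(v := b)) A = val (\<beta>(v := 0)) A + b"
        using A val_fun_upd[of \<beta> v b A] by (simp add: forced_def)
      ultimately show ?thesis unfolding bq
        by (cases "val (\<beta>(v := 0)) A"; cases "val (\<beta>(v := 0)) ?B"; cases s; cases ?t) simp_all
    qed
    have "good g' ?Q (\<beta>(v := b))"
      unfolding good_def
    proof (intro conjI g'(3) allI impI ballI)
      fix x assume "n div 2 \<le> x"
      then show "(\<beta>(v := b)) x = 0"
        using good v by (auto simp: good_def b_def dest: leD)
    next
      fix A s assume A: "A \<in> determined ?Q" "sum f {u \<in> A. g' < blk u} = scaled_top s"
      show "val (\<beta>(v := b)) A = s"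
      proof (cases "parity A v = 1")
        case True then show ?thesis using A by (intro b) (simp add: forced_def)
      next
        case pv: False
        then have AQ: "A \<in> determined Q" using A(1) by (auto simp: determined_def)
        have "val (\<beta>(v := b)) A = val \<beta> A" using False by (intro val_cong[OF AQ]) auto
        then show ?thesis using old[OF AQ A(2)] by simp
      qed
    qed
    then show ?thesis using g' False by blast
  qed
qed

text \<open>The relation symbol \<open>R < M\<close> stands for the equation defining value \<open>R\<close>, and \<open>M\<close> for the
  equation on the last value. The element \<open>a\<close> of the universe is the variable \<open>a div 2\<close> with
  value \<open>a mod 2\<close>; for odd \<open>n\<close> the element \<open>n - 1\<close> is padding.\<close>

definition constr :: "nat \<Rightarrow> nat list" where
  "constr R = (if R = M then [top] else R # preds R)"

definition tuple :: "nat \<Rightarrow> nat list" where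
  "tuple R = concat (map (\<lambda>u. map (\<gamma> u) [0..<D]) (constr R))"

definition voc :: "nat vocabulary" where
  "voc R = (if R \<le> M then Some (length (tuple R)) else None)"

text \<open>Each symbol holds only of elements for one fixed tuple of variables, so it identifies
  the variables of its equation and also states the equation. \<open>of_nat\<close> into
  \<open>bit\<close> reads off the value of an element as its parity.\<close>

definition xor_structure :: "bit \<Rightarrow> (nat, nat) rel_structure" where
  "xor_structure c = \<lparr>univ = {..<n},
     interp = (\<lambda>R. {as. map (\<lambda>a. a div 2) as = tuple R \<and>
        sum_list (map of_nat as) = (if R = M then c else 0)})\<rparr>"

lemma constr_less:
  assumes "R \<le> M" shows "set (constr R) \<subseteq> {..<M}"
proof (cases "R = M")
  case False
  then have "R < M" using assms by simp
  then show ?thesis using preds_less[of R] by (auto simp: constr_def dest: less_trans)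
qed (simp add: constr_def top_less)

lemma constr_distinct: "R \<le> M \<Longrightarrow> distinct (constr R)"
  using preds_distinct[of R] by (auto simp: constr_def)

lemma constr_length: "R \<le> M \<Longrightarrow> 1 \<le> length (constr R) \<and> length (constr R) \<le> 3"
  using preds_length[of R] by (auto simp: constr_def)

lemma length_tuple: "length (tuple R) = length (constr R) * D"
  by (simp add: tuple_def length_concat o_def sum_list_triv)

lemma set_tuple: "set (tuple R) = (\<Union>u\<in>set (constr R). \<gamma> u ` {..<D})"
  by (auto simp: tuple_def)

lemma sum_list_tuple:
  fixes \<beta> :: "nat \<Rightarrow> bit"
  assumes "R \<le> M" shows "sum_list (map \<beta> (tuple R)) = val \<beta> (set (constr R))"
proof -
  have "sum_list (map \<beta> (tuple R)) = sum_list (map (\<lambda>u. \<Sum>i<D. \<beta> (\<gamma> u i)) (constr R))"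
    proof -
    have "sum_list (map \<beta> (concat (map (\<lambda>u. map (\<gamma> u) [0..<D]) us)))
        = sum_list (map (\<lambda>u. \<Sum>i<D. \<beta> (\<gamma> u i)) us)" for us
      by (induction us) (simp_all add: o_def
          interv_sum_list_conv_sum_set_nat atLeast0LessThan)
    then show ?thesis by (simp only: tuple_def)
  qed
  then show ?thesis
    using constr_distinct[OF assms] by (simp add: val_def sum_list_distinct_conv_sum_set)
qed

lemma kary_xor_structure:
  assumes "3 * D \<le> k" shows "kary_structure k voc (xor_structure c)"
proof -
  have "dom voc = {..M}" by (auto simp: voc_def dom_def)
  moreover have "1 \<le> length (tuple R) \<and> length (tuple R) \<le> k" if "R \<le> M" for R
  proof -
    have "1 * 1 \<le> length (constr R) * D" by (intro mult_le_mono) (use constr_length[OF that] D in auto)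
    moreover have "length (constr R) * D \<le> 3 * D" using constr_length[OF that] by simp
    ultimately show ?thesis using assms unfolding length_tuple by linarith
  qed
  ultimately have "kary_vocabulary k voc" by (auto simp: kary_vocabulary_def voc_def)
  moreover have "finite_structure voc (xor_structure c)"
    unfolding finite_structure_def
  proof (intro conjI allI impI)
    show "finite (univ (xor_structure c))" by (simp add: xor_structure_def)
    have "\<gamma> top 0 < n div 2" using top_less D by (intro \<gamma>_less) auto
    then show "univ (xor_structure c) \<noteq> {}" by (auto simp: xor_structure_def lessThan_empty_iff)
    fix R r assume "voc R = Some r"
    then have R: "R \<le> M" "r = length (tuple R)" by (auto simp: voc_def split: if_splits)
    show "interp (xor_structure c) R \<subseteq> {as. length as = r \<and> set as \<subseteq> univ (xor_structure c)}"
    proof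
      fix as assume "as \<in> interp (xor_structure c) R"
      then have as: "map (\<lambda>a. a div 2) as = tuple R" by (simp add: xor_structure_def)
      have "length as = r" using arg_cong[OF as, of length] R by simp
      moreover have "a < n" if "a \<in> set as" for a
      proof -
        have "a div 2 \<in> set (tuple R)" using that unfolding as[symmetric] by simp
        then have "a div 2 < n div 2"
          using \<gamma>_less constr_less[OF R(1)] by (auto simp: set_tuple)
        then show ?thesis by linarith
      qed
      ultimately show "as \<in> {as. length as = r \<and> set as \<subseteq> univ (xor_structure c)}"
        by (auto simp: xor_structure_def)
    qed
  qed
  ultimately show ?thesis by (simp add: kary_structure_def)
qed

text \<open>A fully pebbled equation is a determined set of at most three values. If it lies below
  the gap, as the equations for the inputs in block 0 do, nothing contributes. If it lies above, its
  predecessors cannot jump over the untouched block, and \<open>f_step\<close> makes the sum vanish.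
  Only the equation on \<open>top\<close> leaves \<open>f top\<close>.\<close>

lemma good_constr:
  assumes good: "good g Q \<beta>" and g: "1 \<le> g" "g < blk top" and R: "R \<le> M"
    and sub: "set (tuple R) \<subseteq> Q"
  shows "val \<beta> (set (constr R)) = of_bool (R = M)"
proof -
  let ?A = "set (constr R)"
  have "card ?A \<le> d" using card_length[of "constr R"] constr_length[OF R] d by linarith
  moreover have "v \<in> Q" if "parity ?A v = 1" for v
    using parity_oneD[OF that] sub by (auto simp: set_tuple)
  ultimately have A: "?A \<in> determined Q" using constr_less[OF R] by (simp add: determined_def)
  then have ng: "blk u \<noteq> g" if "u \<in> ?A" for u
    using good that by (auto simp: good_def closure_def)
  have "sum f {u \<in> ?A. g < blk u} = scaled_top (of_bool (R = M))"
  proof (cases "R = M")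
    case True
    then have "{u \<in> ?A. g < blk u} = {top}" using g by (auto simp: constr_def)
    then show ?thesis using True by (simp add: scaled_top_def)
  next
    case False
    then have RM: "R < M" and con: "constr R = R # preds R" using R by (simp_all add: constr_def)
    show ?thesis
    proof (cases "blk R < g")
      case True
      have "blk u < g" if "u \<in> ?A" for u
      proof -
        have "u \<le> R" using that con preds_less[OF RM] by (auto intro: less_imp_le)
        then show ?thesis using blk_mono[of u R] True by simp
      qed
      then have empty: "{u \<in> ?A. g < blk u} = {}" by fastforce
      show ?thesis unfolding empty using False by (simp add: scaled_top_def)
    next
      case gt: False
      then have "g < blk R" using ng[of R] con by auto
      moreover have "g < blk p" if "p \<in> set (preds R)" for p
        using preds_blk[OF RM that] ng[of p] that con \<open>g < blk R\<close> by auto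
      ultimately have "{u \<in> ?A. g < blk u} = insert R (set (preds R))" using con by auto
      moreover have "R \<notin> set (preds R)" using preds_distinct[OF RM] by simp
      moreover have "f R = sum f (set (preds R))" using f_step[OF RM] \<open>g < blk R\<close> by simp
      ultimately show ?thesis using False by (simp add: scaled_top_def vec_add_self)
    qed
  qed
  then show ?thesis using good A by (auto simp: good_def)
qed

end

section \<open>Equivalence in counting logic\<close>

definition flip :: "bit \<Rightarrow> nat \<Rightarrow> nat" where
  "flip b a = (if b = 1 then if even a then a + 1 else a - 1 else a)"

lemma flip_div: "flip b a div 2 = a div 2"
proof (cases "b = 1")
  case True
  have "even a \<Longrightarrow> (a + 1) div 2 = a div 2" "odd a \<Longrightarrow> (a - 1) div 2 = a div 2"
    by presburger+
  then show ?thesis using True by (simp only: flip_def split: if_split) simp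
qed (simp add: flip_def)

lemma flip_flip: "flip b (flip b a) = a"
proof (cases "b = 1")
  case True
  have "odd a \<Longrightarrow> even (a - 1) \<and> a - 1 + 1 = a" by presburger
  then show ?thesis using True by (cases "even a") (simp_all add: flip_def)
qed (simp add: flip_def)

lemma of_nat_flip: "(of_nat (flip b a) :: bit) = of_nat a + b"
proof (cases "b = 1")
  case True
  show ?thesis
  proof (cases "even a")
    case False
    then obtain c where "a = Suc c" by (cases a) auto
    then show ?thesis using \<open>b = 1\<close> False by (simp add: flip_def)
  qed (simp add: flip_def \<open>b = 1\<close>)
qed (simp add: flip_def)

lemma sat_cong: "(\<And>i. i \<in> fv \<phi> \<Longrightarrow> s i = t i) \<Longrightarrow> sat A s \<phi> = sat A t \<phi>"
proof (induction \<phi> arbitrary: s t)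
  case (Rel R xs)
  then have "map s xs = map t xs" by simp
  then show ?case by (simp only: sat.simps)
next
  case (Neg \<phi>)
  have "sat A s \<phi> = sat A t \<phi>" by (rule Neg.IH) (use Neg.prems in simp)
  then show ?case by simp
next
  case (Conj \<phi> \<psi>)
  have "sat A s \<phi> = sat A t \<phi>" by (rule Conj.IH(1)) (use Conj.prems in simp)
  moreover have "sat A s \<psi> = sat A t \<psi>" by (rule Conj.IH(2)) (use Conj.prems in simp)
  ultimately show ?case by simp
next
  case (Ex x \<phi>)
  have "sat A (s(x := a)) \<phi> = sat A (t(x := a)) \<phi>" for a
    using Ex.prems by (intro Ex.IH) auto
  then show ?case by simp
next
  case (CEx j x \<phi>)
  have "sat A (s(x := a)) \<phi> = sat A (t(x := a)) \<phi>" for a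
    using CEx.prems by (intro CEx.IH) auto
  then show ?case by simp
qed simp

context compressed_program
begin

text \<open>For odd n the padding element has index \<open>n div 2\<close>, where
  \<open>good\<close> makes \<open>\<beta>\<close> zero; every other flip stays within a pair below
  n.\<close>

lemma flip_less:
  assumes "good g Q \<beta>" "a < n" shows "flip (\<beta> (a div 2)) a < n"
proof (cases "a div 2 < n div 2")
  case True
  then have "flip (\<beta> (a div 2)) a div 2 < n div 2" by (simp only: flip_div)
  then show ?thesis by linarith
next
  case False
  then have "\<beta> (a div 2) = 0" using assms(1) by (simp add: good_def)
  then show ?thesis using assms(2) by (simp add: flip_def)
qed

text \<open>The flip for each possible new variable is fixed before an element is chosen. Flipping
  inside the pairs is an involution, so the answers form one bijection, which serves existential and
  counting quantifiers alike. The new gap may depend on the chosen element.\<close>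

lemma quantifier_step:
  assumes W: "finite W" "card W \<le> d" "x \<in> W"
    and s: "\<forall>i\<in>W. s i < n" "\<forall>i\<in>W. s' i = flip (\<beta> (s i div 2)) (s i)"
    and good: "good g ((\<lambda>i. s i div 2) ` W) \<beta>" and g: "d + 2 \<le> g" "g < blk top"
  obtains \<pi> where "bij_betw \<pi> {..<n} {..<n}"
    and "\<And>a. a < n \<Longrightarrow> \<exists>\<beta>' g'. g \<le> g' + (d + 1) \<and> g' < blk top \<and>
      good g' ((\<lambda>i. (s(x := a)) i div 2) ` W) \<beta>' \<and> (\<forall>i\<in>W. (s(x := a)) i < n) \<and>
      (\<forall>i\<in>W. (s'(x := \<pi> a)) i = flip (\<beta>' ((s(x := a)) i div 2)) ((s(x := a)) i))"
proof -
  \<comment> \<open>The pebble x is lifted first, which makes room for the new variable among the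
    d.\<close>
  let ?Q = "(\<lambda>i. s i div 2) ` (W - {x})"
  have goodQ: "good g ?Q \<beta>" by (rule good_antimono[OF good]) auto
  have finQ: "finite ?Q" using W by simp
  have card: "card (insert v ?Q) \<le> d" for v
  proof -
    have "card (insert v ?Q) \<le> Suc (card ?Q)" using finQ by (simp add: card_insert_if)
    also have "card ?Q \<le> card (W - {x})" using W by (intro card_image_le) simp
    also have "Suc (card (W - {x})) = card W" using W by (intro card.remove[symmetric])
    finally show ?thesis using W by simp
  qed
  have "\<forall>v. \<exists>b. \<exists>g'. g \<le> g' + (d + 1) \<and> g' < g \<and> good g' (insert v ?Q) (\<beta>(v := b)) \<and>
    (v \<in> ?Q \<longrightarrow> b = \<beta> v)"
    using good_extend[OF goodQ finQ card g] by (rule allI)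
  then obtain b where "\<forall>v. \<exists>g'. g \<le> g' + (d + 1) \<and> g' < g \<and> good g' (insert v ?Q) (\<beta>(v := b v)) \<and>
    (v \<in> ?Q \<longrightarrow> b v = \<beta> v)"
    by (rule choice[THEN exE])
  then obtain G where bG: "\<forall>v. g \<le> G v + (d + 1) \<and> G v < g \<and>
      good (G v) (insert v ?Q) (\<beta>(v := b v)) \<and> (v \<in> ?Q \<longrightarrow> b v = \<beta> v)"
    by (rule choice[THEN exE])
  define \<pi> where "\<pi> a = flip (b (a div 2)) a" for a
  have \<pi>\<pi>: "\<pi> (\<pi> a) = a" for a by (simp add: \<pi>_def flip_div flip_flip)
  have \<pi>n: "\<pi> a < n" if "a < n" for a
    using flip_less[of "G (a div 2)" "insert (a div 2) ?Q" "\<beta>(a div 2 := b (a div 2))" a]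
      bG[rule_format, of "a div 2"] that by (simp add: \<pi>_def)
  show ?thesis
  proof
    show "bij_betw \<pi> {..<n} {..<n}"
      by (rule bij_betwI[where g = \<pi>]) (auto simp: \<pi>\<pi> \<pi>n)
    fix a assume a: "a < n"
    let ?v = "a div 2"
    let ?\<beta> = "\<beta>(?v := b ?v)"
    have Q: "(\<lambda>i. (s(x := a)) i div 2) ` W = insert ?v ?Q"
    proof -
      have "(\<lambda>i. (s(x := a)) i div 2) ` W = (\<lambda>i. (s(x := a)) i div 2) ` insert x (W - {x})"
        using W(3) by (simp only: insert_Diff)
      also have "\<dots> = insert ?v ((\<lambda>i. (s(x := a)) i div 2) ` (W - {x}))"
        by (simp only: image_insert fun_upd_same)
      also have "(\<lambda>i. (s(x := a)) i div 2) ` (W - {x}) = ?Q" by (intro image_cong) simp_all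
      finally show ?thesis .
    qed
    have upd: "(s'(x := \<pi> a)) i = flip (?\<beta> ((s(x := a)) i div 2)) ((s(x := a)) i)" if i: "i \<in> W" for i
    proof (cases "i = x")
      case False
      then have "s i div 2 \<in> ?Q" using i by auto
      then have "?\<beta> (s i div 2) = \<beta> (s i div 2)" using bG[rule_format, of ?v] by auto
      then show ?thesis using False s(2) i by simp
    qed (simp add: \<pi>_def)
    have "good (G ?v) ((\<lambda>i. (s(x := a)) i div 2) ` W) ?\<beta>"
      unfolding Q using bG by blast
    moreover have "g \<le> G ?v + (d + 1)" "G ?v < blk top"
      using bG[rule_format, of ?v] g(2) by simp_all
    moreover have "\<forall>i\<in>W. (s(x := a)) i < n" using s(1) a by simp
    ultimately show "\<exists>\<beta>' g'. g \<le> g' + (d + 1) \<and> g' < blk top \<and>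
      good g' ((\<lambda>i. (s(x := a)) i div 2) ` W) \<beta>' \<and> (\<forall>i\<in>W. (s(x := a)) i < n) \<and>
      (\<forall>i\<in>W. (s'(x := \<pi> a)) i = flip (\<beta>' ((s(x := a)) i div 2)) ((s(x := a)) i))"
      using upd by blast
  qed
qed

lemma univ_xor_structure: "univ (xor_structure c) = {..<n}"
  by (simp add: xor_structure_def)

text \<open>Each quantifier costs at most \<open>d + 1\<close> blocks, and a gap of at least 1 must
  remain at the atoms. All names in the fixed set W count as pebbles, whether free in the current
  subformula or not.\<close>

lemma sat_xor_structure_iff:
  assumes W: "finite W" "card W \<le> d"
  shows "vars \<phi> \<subseteq> W \<Longrightarrow> wf_fm voc \<phi> \<Longrightarrow> \<forall>i\<in>W. s i < n \<Longrightarrow>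
    \<forall>i\<in>W. s' i = flip (\<beta> (s i div 2)) (s i) \<Longrightarrow> good g ((\<lambda>i. s i div 2) ` W) \<beta> \<Longrightarrow>
    1 + qrank \<phi> * (d + 1) \<le> g \<Longrightarrow> g < blk top \<Longrightarrow>
    sat (xor_structure 0) s \<phi> = sat (xor_structure 1) s' \<phi>"
proof (induction \<phi> arbitrary: s s' \<beta> g)
  case (Eq x y)
  have x: "s' x = flip (\<beta> (s x div 2)) (s x)" and y: "s' y = flip (\<beta> (s y div 2)) (s y)"
    using Eq by auto
  have "s x = s y" if "s' x = s' y"
  proof -
    have "s x div 2 = s y div 2" using that x y flip_div by metis
    then show ?thesis using that x y flip_flip by metis
  qed
  then show ?case using x y by auto
next
  case (Rel R xs)
  have R: "R \<le> M" using Rel.prems(2) by (auto simp: voc_def split: if_splits)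
  have xs: "set xs \<subseteq> W" using Rel.prems(1) by simp
  have dv: "map (\<lambda>a. a div 2) (map s' xs) = map (\<lambda>a. a div 2) (map s xs)"
    using Rel.prems(4) xs by (auto simp: flip_div)
  have e: "map (of_nat :: nat \<Rightarrow> bit) (map s' xs) = map (\<lambda>i. of_nat (s i) + \<beta> (s i div 2)) xs"
    using Rel.prems(4) xs by (auto simp: of_nat_flip)
  have sm: "sum_list (map of_nat (map s' xs)) = sum_list (map of_nat (map s xs))
      + sum_list (map \<beta> (map (\<lambda>a. a div 2) (map s xs)))"
    unfolding e by (simp only: sum_list_addf map_map o_def)
  show ?case
  proof (cases "map (\<lambda>a. a div 2) (map s xs) = tuple R")
    case True
    have "set (tuple R) \<subseteq> (\<lambda>i. s i div 2) ` W" unfolding True[symmetric] using xs by auto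
    \<comment> \<open>Flipping changes the XOR of the tuple exactly where the right-hand sides of
      the two structures differ.\<close>
    then have "val \<beta> (set (constr R)) = of_bool (R = M)"
      using good_constr[OF Rel.prems(5) _ Rel.prems(7) R] Rel.prems(6) by simp
    then have "sum_list (map \<beta> (map (\<lambda>a. a div 2) (map s xs))) = of_bool (R = M)"
      unfolding True sum_list_tuple[OF R] .
    then have "sum_list (map of_nat (map s' xs)) = sum_list (map of_nat (map s xs)) + (of_bool (R = M) :: bit)"
      using sm by (simp only:)
    then show ?thesis
      unfolding sat.simps xor_structure_def using True dv
      by (cases "R = M"; cases "sum_list (map of_nat (map s xs)) :: bit") (simp_all del: map_map)
  next
    case False
    then show ?thesis unfolding sat.simps xor_structure_def using dv by (simp del: map_map)
  qed
next
  case (Neg \<phi>)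
  have "sat (xor_structure 0) s \<phi> = sat (xor_structure 1) s' \<phi>"
    by (rule Neg.IH[OF _ _ Neg.prems(3,4,5)]) (use Neg.prems in simp_all)
  then show ?case by simp
next
  case (Conj \<phi> \<psi>)
  have "1 + qrank \<phi> * (d + 1) \<le> g" "1 + qrank \<psi> * (d + 1) \<le> g"
    using Conj.prems(6) mult_le_mono1[of "qrank \<phi>" "max (qrank \<phi>) (qrank \<psi>)" "d + 1"]
      mult_le_mono1[of "qrank \<psi>" "max (qrank \<phi>) (qrank \<psi>)" "d + 1"] by simp_all
  then have "sat (xor_structure 0) s \<phi> = sat (xor_structure 1) s' \<phi>"
    "sat (xor_structure 0) s \<psi> = sat (xor_structure 1) s' \<psi>"
    using Conj.prems(1,2)
    by (simp_all only: vars.simps wf_fm.simps le_sup_iff Conj.IH(1)[OF _ _ Conj.prems(3,4,5) _ Conj.prems(7)]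
        Conj.IH(2)[OF _ _ Conj.prems(3,4,5) _ Conj.prems(7)])
  then show ?case by simp
next
  case (Ex x \<phi>)
  have x: "x \<in> W" and g: "d + 2 \<le> g" using Ex.prems by auto
  obtain \<pi> where \<pi>: "bij_betw \<pi> {..<n} {..<n}"
    and step: "\<And>a. a < n \<Longrightarrow> \<exists>\<beta>' g'. g \<le> g' + (d + 1) \<and> g' < blk top \<and>
      good g' ((\<lambda>i. (s(x := a)) i div 2) ` W) \<beta>' \<and> (\<forall>i\<in>W. (s(x := a)) i < n) \<and>
      (\<forall>i\<in>W. (s'(x := \<pi> a)) i = flip (\<beta>' ((s(x := a)) i div 2)) ((s(x := a)) i))"
    using quantifier_step[OF W x Ex.prems(3,4,5) g Ex.prems(7)] by blast
  have eq: "sat (xor_structure 0) (s(x := a)) \<phi> = sat (xor_structure 1) (s'(x := \<pi> a)) \<phi>" if a: "a < n" for a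
  proof -
    obtain \<beta>' g' where b: "g \<le> g' + (d + 1)" "g' < blk top"
      "good g' ((\<lambda>i. (s(x := a)) i div 2) ` W) \<beta>'" "\<forall>i\<in>W. (s(x := a)) i < n"
      "\<forall>i\<in>W. (s'(x := \<pi> a)) i = flip (\<beta>' ((s(x := a)) i div 2)) ((s(x := a)) i)"
      using step[OF a] by blast
    show ?thesis by (rule Ex.IH[OF _ _ b(4,5,3) _ b(2)]) (use Ex.prems b(1) in auto)
  qed
  have im: "\<pi> ` {..<n} = {..<n}" using \<pi> by (rule bij_betw_imp_surj_on)
  have "(\<exists>a\<in>{..<n}. sat (xor_structure 0) (s(x := a)) \<phi>)
      = (\<exists>a\<in>{..<n}. sat (xor_structure 1) (s'(x := \<pi> a)) \<phi>)"
    by (rule bex_cong[OF refl]) (rule eq, simp)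
  also have "\<dots> = (\<exists>a\<in>\<pi> ` {..<n}. sat (xor_structure 1) (s'(x := a)) \<phi>)" by blast
  finally show ?case unfolding sat.simps univ_xor_structure im .
next
  case (CEx j x \<phi>)
  have x: "x \<in> W" and g: "d + 2 \<le> g" using CEx.prems by auto
  obtain \<pi> where \<pi>: "bij_betw \<pi> {..<n} {..<n}"
    and step: "\<And>a. a < n \<Longrightarrow> \<exists>\<beta>' g'. g \<le> g' + (d + 1) \<and> g' < blk top \<and>
      good g' ((\<lambda>i. (s(x := a)) i div 2) ` W) \<beta>' \<and> (\<forall>i\<in>W. (s(x := a)) i < n) \<and>
      (\<forall>i\<in>W. (s'(x := \<pi> a)) i = flip (\<beta>' ((s(x := a)) i div 2)) ((s(x := a)) i))"
    using quantifier_step[OF W x CEx.prems(3,4,5) g CEx.prems(7)] by blast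
  have eq: "sat (xor_structure 0) (s(x := a)) \<phi> = sat (xor_structure 1) (s'(x := \<pi> a)) \<phi>" if a: "a < n" for a
  proof -
    obtain \<beta>' g' where b: "g \<le> g' + (d + 1)" "g' < blk top"
      "good g' ((\<lambda>i. (s(x := a)) i div 2) ` W) \<beta>'" "\<forall>i\<in>W. (s(x := a)) i < n"
      "\<forall>i\<in>W. (s'(x := \<pi> a)) i = flip (\<beta>' ((s(x := a)) i div 2)) ((s(x := a)) i)"
      using step[OF a] by blast
    show ?thesis by (rule CEx.IH[OF _ _ b(4,5,3) _ b(2)]) (use CEx.prems b(1) in auto)
  qed
  let ?S = "{a \<in> {..<n}. sat (xor_structure 0) (s(x := a)) \<phi>}"
  let ?S' = "{a \<in> {..<n}. sat (xor_structure 1) (s'(x := a)) \<phi>}"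
  have im: "\<pi> ` {..<n} = {..<n}" using \<pi> by (rule bij_betw_imp_surj_on)
  have "?S' = {a \<in> \<pi> ` {..<n}. sat (xor_structure 1) (s'(x := a)) \<phi>}" unfolding im ..
  also have "\<dots> = \<pi> ` {a \<in> {..<n}. sat (xor_structure 1) (s'(x := \<pi> a)) \<phi>}" by blast
  also have "{a \<in> {..<n}. sat (xor_structure 1) (s'(x := \<pi> a)) \<phi>} = ?S"
    by (rule Collect_cong, rule conj_cong[OF refl]) (rule eq[symmetric], simp)
  finally have "card ?S' = card (\<pi> ` ?S)" by (rule arg_cong)
  also have "\<dots> = card ?S"
    by (intro card_image inj_on_subset[OF bij_betw_imp_inj_on[OF \<pi>]]) blast
  finally show ?case unfolding sat.simps univ_xor_structure by (simp only:)
qed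

text \<open>By expansion a nonempty set of at most d values has a variable of odd parity, so without
  pebbles only the empty set is determined. Its sum equals \<open>scaled_top s\<close> only for s =
  0, as \<open>f top\<close> is nonzero.\<close>

lemma good_empty: "good g {} (\<lambda>_. 0)"
proof -
  have "determined {} \<subseteq> {{}}"
  proof
    fix A assume A: "A \<in> determined {}"
    then have AD: "A \<subseteq> {..<M}" "card A \<le> 2 * d" "finite A" using determinedD[OF A] by auto
    have "card A \<le> card (unique_nbrs \<gamma> D (\<Union>{A}))" using expand[OF AD(1,2)] by simp
    also have "\<dots> \<le> card ({} :: nat set)"
      using unique_nbrs_Union_subset[of "{A}" "{}"] A by (intro card_mono) auto
    finally show "A \<in> {{}}" using AD(3) by simp
  qed
  then have empty: "A = {}" if "A \<in> determined {}" for A using that by blast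
  have "val (\<lambda>_. 0) A = s" if "A \<in> determined {}" "sum f {u \<in> A. g < blk u} = scaled_top s" for A s
    using that(2) scaled_top_eq[of s] unfolding empty[OF that(1)] by (simp add: val_def)
  moreover have "closure {} = {}" using empty unfolding closure_def by blast
  ultimately show ?thesis by (simp add: good_def)
qed

lemma models_iff_sat:
  assumes "fv \<phi> = {}" "0 < n"
  shows "models (xor_structure c) \<phi> \<longleftrightarrow> sat (xor_structure c) (\<lambda>_. 0) \<phi>"
proof -
  have "sat (xor_structure c) s \<phi> = sat (xor_structure c) (\<lambda>_. 0) \<phi>" for s
    by (rule sat_cong) (simp add: assms)
  moreover have "range (\<lambda>_. 0::nat) \<subseteq> univ (xor_structure c)"
    using assms(2) by (simp add: univ_xor_structure)
  ultimately show ?thesis unfolding models_def by blast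
qed

end

section \<open>The distinguishing sentence\<close>

lemma sat_foldr_Ex:
  "sat A s (foldr Ex xs \<phi>) \<longleftrightarrow>
     (\<exists>t. (\<forall>i\<in>set xs. t i \<in> univ A) \<and> (\<forall>i. i \<notin> set xs \<longrightarrow> t i = s i) \<and> sat A t \<phi>)"
proof (induction xs arbitrary: s)
  case Nil
  have "t = s" if "\<forall>i. t i = s i" for t using that by blast
  then show ?case by auto
next
  case (Cons x xs)
  show ?case (is "?L \<longleftrightarrow> ?R")
  proof
    assume ?L
    then obtain a t where "a \<in> univ A" "\<forall>i\<in>set xs. t i \<in> univ A"
      "\<forall>i. i \<notin> set xs \<longrightarrow> t i = (s(x := a)) i" "sat A t \<phi>"
      using Cons.IH by auto
    then show ?R by (intro exI[of _ t]) (cases "x \<in> set xs"; auto)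
  next
    assume ?R
    then obtain t where t: "\<forall>i\<in>set (x # xs). t i \<in> univ A" "\<forall>i. i \<notin> set (x # xs) \<longrightarrow> t i = s i"
      "sat A t \<phi>" by blast
    then have "sat A (s(x := t x)) (foldr Ex xs \<phi>)"
      unfolding Cons.IH by (intro exI[of _ t]) auto
    then show ?L using t(1) by auto
  qed
qed

lemma foldr_Ex_simps:
  "wf_fm \<tau> (foldr Ex xs \<phi>) = wf_fm \<tau> \<phi>" "is_FO (foldr Ex xs \<phi>) = is_FO \<phi>"
  "vars (foldr Ex xs \<phi>) = set xs \<union> vars \<phi>" "fv (foldr Ex xs \<phi>) = fv \<phi> - set xs"
  by (induction xs) auto

context compressed_program
begin

definition var_block :: "nat \<Rightarrow> nat list" where
  "var_block b = map (\<lambda>i. b * D + i) [0..<D]"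

text \<open>With zero initial state every computed value is 0, so the formulas need not pass bits
  along. A register is a block of D first-order variables.\<close>

definition reads_zero :: "nat \<Rightarrow> nat \<Rightarrow> (nat \<Rightarrow> nat) \<Rightarrow> bool" where
  "reads_zero u b s \<longleftrightarrow> map (\<lambda>i. s i div 2) (var_block b) = map (\<gamma> u) [0..<D] \<and>
     sum_list (map (\<lambda>i. of_nat (s i) :: bit) (var_block b)) = 0"

text \<open>The element \<open>2 * v\<close> is variable v with value 0, so the all-zero assignment
  supplies the witnesses.\<close>

definition fill :: "nat \<Rightarrow> nat \<Rightarrow> (nat \<Rightarrow> nat) \<Rightarrow> nat \<Rightarrow> nat" where
  "fill u b s i = (if i \<in> set (var_block b) then 2 * \<gamma> u (i - b * D) else s i)"

lemma length_var_block: "length (var_block b) = D"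
  by (simp add: var_block_def)

lemma set_var_block: "set (var_block b) = {b * D..<b * D + D}"
  by (auto simp: var_block_def image_iff)

lemma var_block_disjoint:
  assumes "b \<noteq> c" shows "set (var_block b) \<inter> set (var_block c) = {}"
proof -
  have "x < c * D \<or> c * D + D \<le> x" if "b * D \<le> x" "x < b * D + D" for x
  proof (cases "b < c")
    case True
    then have "Suc b * D \<le> c * D" by (intro mult_le_mono1) simp
    then show ?thesis using that by simp
  next
    case False
    then have "Suc c * D \<le> b * D" using assms by (intro mult_le_mono1) simp
    then show ?thesis using that by simp
  qed
  then show ?thesis unfolding set_var_block by fastforce
qed

lemma var_block_bound: "b < 3 \<Longrightarrow> set (var_block b) \<subseteq> {..<3 * D}"
proof -
  assume "b < 3"
  then have "Suc b * D \<le> 3 * D" by (intro mult_le_mono1) simp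
  then have "b * D + D \<le> 3 * D" by (simp only: mult_Suc add.commute)
  then show ?thesis unfolding set_var_block
    by (intro subsetI) (simp only: atLeastLessThan_iff lessThan_iff, linarith)
qed

lemma reads_zero_cong:
  assumes "\<And>i. i \<in> set (var_block b) \<Longrightarrow> s i = t i" shows "reads_zero u b s = reads_zero u b t"
proof -
  have "map (\<lambda>i. s i div 2) (var_block b) = map (\<lambda>i. t i div 2) (var_block b)"
    "map (\<lambda>i. of_nat (s i) :: bit) (var_block b) = map (\<lambda>i. of_nat (t i)) (var_block b)"
    using assms by simp_all
  then show ?thesis by (simp only: reads_zero_def)
qed

lemma reads_zero_fill: "reads_zero u b (fill u b s)"
proof -
  have "map (\<lambda>i. fill u b s i div 2) (var_block b) = map (\<gamma> u) [0..<D]"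
    unfolding var_block_def map_map
    by (intro map_cong refl) (simp add: fill_def set_var_block)
  moreover have "map (\<lambda>i. of_nat (fill u b s i) :: bit) (var_block b) = map (\<lambda>i. 0) (var_block b)"
    by (intro map_cong refl) (simp add: fill_def)
  ultimately show ?thesis unfolding reads_zero_def by (simp only: sum_list_0)
qed

lemma fill_less: "u < M \<Longrightarrow> i \<in> set (var_block b) \<Longrightarrow> fill u b s i < n"
proof -
  assume "u < M" and i: "i \<in> set (var_block b)"
  then have "\<gamma> u (i - b * D) < n div 2" by (intro \<gamma>_less) (auto simp: set_var_block)
  then show ?thesis using i by (simp add: fill_def)
qed

lemma interp_xor_structure:
  "as \<in> interp (xor_structure c) R \<longleftrightarrow> map (\<lambda>a. a div 2) as = tuple R \<and>
      sum_list (map of_nat as) = (if R = M then c else 0)"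
  by (simp add: xor_structure_def)

text \<open>Three blocks of variables suffice: the formula for a predecessor may reuse the block of the
  value it is computed for.\<close>

lemma ex_zero_formula:
  assumes "u < M" "b < 3"
  shows "\<exists>\<phi>. wf_fm voc \<phi> \<and> is_FO \<phi> \<and> vars \<phi> \<subseteq> {..<3 * D} \<and> fv \<phi> \<subseteq> set (var_block b) \<and>
    (\<forall>c s. sat (xor_structure c) s \<phi> \<longleftrightarrow> reads_zero u b s)"
  using assms
proof (induction u arbitrary: b rule: less_induct)
  case (less u)
  let ?b1 = "(b + 1) mod 3" and ?b2 = "(b + 2) mod 3"
  let ?V = var_block
  have b: "b = 0 \<or> b = 1 \<or> b = 2" using less.prems(2) by auto
  then have neq: "b \<noteq> ?b1" "b \<noteq> ?b2" "?b1 \<noteq> ?b2" and b3: "?b1 < 3" "?b2 < 3" by auto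
  note disj = var_block_disjoint[OF neq(1)] var_block_disjoint[OF neq(2)] var_block_disjoint[OF neq(3)]
  note bound = var_block_bound[OF less.prems(2)] var_block_bound[OF b3(1)] var_block_bound[OF b3(2)]
  have uM: "u \<noteq> M" "u < M" using less.prems by auto
  have con: "constr u = u # preds u" using uM by (simp add: constr_def)
  have IH: "\<exists>\<phi>. wf_fm voc \<phi> \<and> is_FO \<phi> \<and> vars \<phi> \<subseteq> {..<3 * D} \<and> fv \<phi> \<subseteq> set (?V b') \<and>
    (\<forall>c s. sat (xor_structure c) s \<phi> \<longleftrightarrow> reads_zero p b' s)" if "p \<in> set (preds u)" "b' < 3" for p b'
    using less.IH[of p b'] preds_less[OF uM(2) that(1)] that uM by simp
  have pM: "p < M" if "p \<in> set (preds u)" for p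
    using preds_less[OF uM(2) that] uM by simp
  consider "preds u = []" | p where "preds u = [p]" | p q where "preds u = [p, q]"
  proof (cases "preds u")
    case (Cons p ps)
    then show ?thesis using that(2,3) preds_length[OF uM(2)] by (cases ps) auto
  qed (use that in blast)
  then show ?case
  proof cases
    case 1
    have "wf_fm voc (Rel u (?V b))"
      using uM 1 by (simp add: voc_def length_tuple con length_var_block)
    moreover have "sat (xor_structure c) s (Rel u (?V b)) \<longleftrightarrow> reads_zero u b s" for c s
      using uM 1 unfolding sat.simps interp_xor_structure reads_zero_def
      by (simp add: tuple_def con o_def)
    ultimately show ?thesis using bound(1) by (intro exI[of _ "Rel u (?V b)"]) simp
  next
    case (2 p)
    obtain \<phi> where \<phi>: "wf_fm voc \<phi>" "is_FO \<phi>" "vars \<phi> \<subseteq> {..<3 * D}" "fv \<phi> \<subseteq> set (?V ?b1)"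
      "\<And>c s. sat (xor_structure c) s \<phi> \<longleftrightarrow> reads_zero p ?b1 s"
      using IH[of p ?b1] 2 b3 by auto
    let ?\<psi> = "foldr Ex (?V ?b1) (Conj \<phi> (Rel u (?V b @ ?V ?b1)))"
    have rel: "reads_zero p ?b1 t \<Longrightarrow>
        sat (xor_structure c) t (Rel u (?V b @ ?V ?b1)) \<longleftrightarrow> reads_zero u b t" for c t
      using uM 2 unfolding sat.simps interp_xor_structure reads_zero_def
      by (auto simp: tuple_def con o_def length_var_block)
    have "sat (xor_structure c) s ?\<psi> \<longleftrightarrow> reads_zero u b s" for c s
    proof
      assume "sat (xor_structure c) s ?\<psi>"
      then obtain t where t: "\<forall>i. i \<notin> set (?V ?b1) \<longrightarrow> t i = s i" "reads_zero p ?b1 t"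
        "sat (xor_structure c) t (Rel u (?V b @ ?V ?b1))"
        unfolding sat_foldr_Ex using \<phi>(5) by auto
      have "reads_zero u b t" using t(3) rel[OF t(2)] by blast
      moreover have "reads_zero u b t = reads_zero u b s"
        using t(1) disj(1) by (intro reads_zero_cong) blast
      ultimately show "reads_zero u b s" by simp
    next
      assume s: "reads_zero u b s"
      let ?t = "fill p ?b1 s"
      have off: "\<forall>i. i \<notin> set (?V ?b1) \<longrightarrow> ?t i = s i" by (simp add: fill_def)
      have "reads_zero u b ?t = reads_zero u b s"
        using off disj(1) by (intro reads_zero_cong) blast
      then have "sat (xor_structure c) ?t (Rel u (?V b @ ?V ?b1))"
        using rel[OF reads_zero_fill] s by blast
      moreover have "\<forall>i\<in>set (?V ?b1). ?t i \<in> univ (xor_structure c)"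
        using fill_less[of p] pM 2 by (simp add: univ_xor_structure)
      ultimately show "sat (xor_structure c) s ?\<psi>"
        unfolding sat_foldr_Ex using off \<phi>(5) reads_zero_fill by (intro exI[of _ ?t]) simp
    qed
    moreover have "wf_fm voc ?\<psi>"
      using \<phi>(1) uM 2 by (simp add: foldr_Ex_simps voc_def length_tuple con length_var_block)
    moreover have "is_FO ?\<psi>" "vars ?\<psi> \<subseteq> {..<3 * D}" "fv ?\<psi> \<subseteq> set (?V b)"
      using \<phi>(2,3,4) bound by (auto simp: foldr_Ex_simps)
    ultimately show ?thesis by blast
  next
    case (3 p q)
    obtain \<phi> where \<phi>: "wf_fm voc \<phi>" "is_FO \<phi>" "vars \<phi> \<subseteq> {..<3 * D}" "fv \<phi> \<subseteq> set (?V ?b1)"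
      "\<And>c s. sat (xor_structure c) s \<phi> \<longleftrightarrow> reads_zero p ?b1 s"
      using IH[of p ?b1] 3 b3 by auto
    obtain \<chi> where \<chi>: "wf_fm voc \<chi>" "is_FO \<chi>" "vars \<chi> \<subseteq> {..<3 * D}" "fv \<chi> \<subseteq> set (?V ?b2)"
      "\<And>c s. sat (xor_structure c) s \<chi> \<longleftrightarrow> reads_zero q ?b2 s"
      using IH[of q ?b2] 3 b3 by auto
    \<comment> \<open>The equation is placed in the innermost scope, where all three registers are
      still held.\<close>
    let ?R = "Rel u (?V b @ ?V ?b1 @ ?V ?b2)"
    let ?\<theta> = "foldr Ex (?V ?b2) (Conj \<chi> ?R)"
    let ?\<psi> = "foldr Ex (?V ?b1) (Conj \<phi> ?\<theta>)"
    have rel: "reads_zero p ?b1 t \<Longrightarrow> reads_zero q ?b2 t \<Longrightarrow>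
        sat (xor_structure c) t ?R \<longleftrightarrow> reads_zero u b t" for c t
      using uM 3 unfolding sat.simps interp_xor_structure reads_zero_def
      by (auto simp: tuple_def con o_def length_var_block)
    have "sat (xor_structure c) s ?\<psi> \<longleftrightarrow> reads_zero u b s" for c s
    proof
      assume "sat (xor_structure c) s ?\<psi>"
      then obtain t where t: "\<forall>i. i \<notin> set (?V ?b1) \<longrightarrow> t i = s i" "reads_zero p ?b1 t"
        "sat (xor_structure c) t ?\<theta>"
        unfolding sat_foldr_Ex[of _ s] using \<phi>(5) by auto
      then obtain t' where t': "\<forall>i. i \<notin> set (?V ?b2) \<longrightarrow> t' i = t i" "reads_zero q ?b2 t'"
        "sat (xor_structure c) t' ?R"
        unfolding sat_foldr_Ex[of _ t] using \<chi>(5) by auto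
      have "reads_zero p ?b1 t' = reads_zero p ?b1 t"
        using t'(1) disj(3) by (intro reads_zero_cong) blast
      then have "reads_zero u b t'" using t' t(2) rel by blast
      moreover have "t' i = s i" if "i \<in> set (?V b)" for i
      proof -
        have "i \<notin> set (?V ?b1)" "i \<notin> set (?V ?b2)" using that disj by blast+
        then show ?thesis using t(1) t'(1) by simp
      qed
      then have "reads_zero u b t' = reads_zero u b s" by (rule reads_zero_cong)
      ultimately show "reads_zero u b s" by simp
    next
      assume s: "reads_zero u b s"
      let ?t = "fill p ?b1 s"
      let ?t' = "fill q ?b2 ?t"
      have off: "\<forall>i. i \<notin> set (?V ?b1) \<longrightarrow> ?t i = s i" by (simp add: fill_def)
      have off': "\<forall>i. i \<notin> set (?V ?b2) \<longrightarrow> ?t' i = ?t i" by (simp add: fill_def)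
      have "?t' i = s i" if "i \<in> set (?V b)" for i
      proof -
        have "i \<notin> set (?V ?b1)" "i \<notin> set (?V ?b2)" using that disj by blast+
        then show ?thesis using off off' by simp
      qed
      then have ub: "reads_zero u b ?t'" using s reads_zero_cong[of b ?t' s u] by blast
      have "reads_zero p ?b1 ?t' = reads_zero p ?b1 ?t"
        using off' disj(3) by (intro reads_zero_cong) blast
      then have "sat (xor_structure c) ?t' ?R"
        using rel[OF _ reads_zero_fill] reads_zero_fill ub by blast
      moreover have "\<forall>i\<in>set (?V ?b2). ?t' i \<in> univ (xor_structure c)"
        using fill_less[of q] pM 3 by (simp add: univ_xor_structure)
      ultimately have "sat (xor_structure c) ?t ?\<theta>"
        unfolding sat_foldr_Ex[of _ ?t] using off' \<chi>(5) reads_zero_fill by (intro exI[of _ ?t']) simp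
      moreover have "\<forall>i\<in>set (?V ?b1). ?t i \<in> univ (xor_structure c)"
        using fill_less[of p] pM 3 by (simp add: univ_xor_structure)
      ultimately show "sat (xor_structure c) s ?\<psi>"
        unfolding sat_foldr_Ex[of _ s] using off \<phi>(5) reads_zero_fill by (intro exI[of _ ?t]) simp
    qed
    moreover have "wf_fm voc ?\<psi>"
      using \<phi>(1) \<chi>(1) uM 3 by (simp add: foldr_Ex_simps voc_def length_tuple con length_var_block)
    moreover have "is_FO ?\<psi>" "vars ?\<psi> \<subseteq> {..<3 * D}" "fv ?\<psi> \<subseteq> set (?V b)"
      using \<phi>(2,3,4) \<chi>(2,3,4) bound by (auto simp: foldr_Ex_simps)
    ultimately show ?thesis by blast
  qed
qed

text \<open>The formula for \<open>top\<close> means the same in both structures. Applying the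
  symbol \<open>M\<close> to the same register then compares its XOR, which is 0, with the
  right-hand side c.\<close>

lemma distinguishing_sentence:
  assumes "3 * D \<le> k"
  shows "\<exists>\<phi>\<in>FO_sentences voc k. models (xor_structure 0) \<phi> \<and> \<not> models (xor_structure 1) \<phi>"
proof -
  obtain \<phi> where \<phi>: "wf_fm voc \<phi>" "is_FO \<phi>" "vars \<phi> \<subseteq> {..<3 * D}" "fv \<phi> \<subseteq> set (var_block 0)"
    "\<And>c s. sat (xor_structure c) s \<phi> \<longleftrightarrow> reads_zero top 0 s"
    using ex_zero_formula[OF top_less, of 0] by auto
  let ?\<psi> = "foldr Ex (var_block 0) (Conj \<phi> (Rel M (var_block 0)))"
  have rel: "reads_zero top 0 t \<Longrightarrow> sat (xor_structure c) t (Rel M (var_block 0)) \<longleftrightarrow> c = 0" for c t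
    unfolding sat.simps interp_xor_structure reads_zero_def
    by (auto simp: tuple_def constr_def o_def)
  have sat: "sat (xor_structure c) s ?\<psi> \<longleftrightarrow> c = 0" for c s
  proof
    assume "sat (xor_structure c) s ?\<psi>"
    then show "c = 0" unfolding sat_foldr_Ex using \<phi>(5) rel by auto
  next
    assume "c = 0"
    let ?t = "fill top 0 s"
    have "\<forall>i\<in>set (var_block 0). ?t i \<in> univ (xor_structure c)"
      using fill_less[of top] top_less by (simp add: univ_xor_structure)
    then show "sat (xor_structure c) s ?\<psi>"
      unfolding sat_foldr_Ex using \<phi>(5) rel[OF reads_zero_fill] reads_zero_fill \<open>c = 0\<close>
      by (intro exI[of _ ?t]) (simp add: fill_def)
  qed
  have "\<gamma> top 0 < n div 2" using top_less D by (intro \<gamma>_less) auto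
  then have n: "0 < n" by simp
  have vars: "vars ?\<psi> \<subseteq> {..<3 * D}"
    using \<phi>(3) var_block_bound[of 0] by (auto simp: foldr_Ex_simps)
  have fv: "fv ?\<psi> = {}" using \<phi>(4) by (auto simp: foldr_Ex_simps)
  have "card (vars ?\<psi>) \<le> k" using card_mono[OF _ vars] assms by simp
  moreover have "wf_fm voc ?\<psi>"
    using \<phi>(1) by (simp add: foldr_Ex_simps voc_def length_tuple constr_def length_var_block)
  moreover have "is_FO ?\<psi>" using \<phi>(2) by (simp add: foldr_Ex_simps)
  ultimately have "?\<psi> \<in> FO_sentences voc k" using fv by (simp add: FO_sentences_def)
  then show ?thesis using models_iff_sat[OF fv n] sat by (intro bexI[of _ ?\<psi>]) auto
qed

lemma indistinguishable:
  assumes wf: "wf_fm voc \<psi>" and fv: "fv \<psi> = {}" and vars: "card (vars \<psi>) \<le> d"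
    and rank: "1 + (qrank \<psi> + 1) * (d + 1) < blk top"
  shows "models (xor_structure 0) \<psi> \<longleftrightarrow> models (xor_structure 1) \<psi>"
proof -
  have "\<gamma> top 0 < n div 2" using top_less D by (intro \<gamma>_less) auto
  then have n: "0 < n" by simp
  have fin: "finite (vars \<psi>)" by (induction \<psi>) auto
  \<comment> \<open>Assignments are total, so the start position already points at element 0.
    Pebbling its variable is charged as one more round, hence
    \<open>qrank \<psi> + 1\<close>.\<close>
  define g where "g = 1 + (qrank \<psi> + 1) * (d + 1)"
  have g: "g < blk top" "d + 2 \<le> g" using rank by (simp_all add: g_def)
  obtain b g' where b: "g \<le> g' + (d + 1)" "g' < g" "good g' {0} ((\<lambda>_. 0::bit)(0 := b))"
    using good_extend[OF good_empty _ _ g(2,1), of 0] d by auto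
  let ?\<beta> = "(\<lambda>_::nat. 0::bit)(0 := b)"
  let ?s = "\<lambda>_::nat. 0::nat" and ?s' = "\<lambda>_::nat. flip (?\<beta> 0) 0"
  have good: "good g' ((\<lambda>i. ?s i div 2) ` vars \<psi>) ?\<beta>"
    by (rule good_antimono[OF b(3)]) auto
  have "sat (xor_structure 0) ?s \<psi> = sat (xor_structure 1) ?s' \<psi>"
    by (rule sat_xor_structure_iff[OF fin vars subset_refl wf _ _ good])
      (use n b g in \<open>auto simp: g_def\<close>)
  also have "\<dots> = sat (xor_structure 1) ?s \<psi>" by (rule sat_cong) (simp add: fv)
  finally show ?thesis by (simp only: models_iff_sat[OF fv n])
qed

end

section \<open>Parameters\<close>

text \<open>The first bound is proved squared: one factor \<open>n ^ e\<close> pays for the number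
  of values and \<open>4 * d\<close>, another one for \<open>((4 * e * d) ^ 6) ^ e\<close>, and
  together they fit into \<open>((n div 2) ^ 2) ^ e\<close>.\<close>

lemma parameter_bounds:
  fixes n d k :: nat
  assumes k: "250 \<le> k" "k \<le> d" and n: "40000 * d ^ 8 * k ^ 6 \<le> n"
  defines "e \<equiv> k div 9" and "h \<equiv> n ^ (k div 50)" and "w \<equiv> n ^ 3"
  shows "4 * d * (h * (w * w)) * (4 * e * d) ^ (3 * e) \<le> (n div 2) ^ e"
    and "h * (h * (w * w)) ^ (2 * d + 1) + 1 < 2 ^ w"
    and "1 \<le> w" and "2 \<le> h" and "4 * d \<le> n" and "5 \<le> n"
proof -
  let ?q = "k div 50"
  have d1: "1 \<le> d" and k1: "1 \<le> k" using k by auto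
  have e1: "1 \<le> d ^ 7" "1 \<le> k ^ 6" using d1 k1 by (simp_all add: Suc_le_eq)
  have "40000 * d \<le> 40000 * d ^ 8 * k ^ 6"
  proof -
    have "d * 1 * 1 \<le> d * d ^ 7 * k ^ 6" using e1 by (intro mult_le_mono) auto
    moreover have "d ^ 8 = d * d ^ 7" using power_Suc[of d 7] by simp
    ultimately show ?thesis by (simp only: mult.assoc mult_1_right)
  qed
  then have nd: "40000 * d \<le> n" using n by linarith
  show n4: "4 * d \<le> n" and n5: "5 \<le> n" using nd d1 by auto
  show w1: "1 \<le> w" using n5 by (simp add: w_def Suc_le_eq)
  have q1: "1 \<le> ?q" using k by simp
  have "n ^ 1 \<le> n ^ ?q" using q1 n5 by (intro power_increasing) auto
  then show "2 \<le> h" using n5 by (simp add: h_def)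
  have M: "h * (w * w) = n ^ (?q + 6)"
    unfolding h_def w_def by (simp add: power_add[symmetric])
  \<comment> \<open>The product \<open>9 * 4 ^ 6 = 36864\<close> explains the constant 40000; the 9
    compensates for replacing n by \<open>n div 2\<close>, which is at least n / 3.\<close>
  have e6: "9 * (4 * e * d) ^ 6 \<le> n"
  proof -
    have "(4 * e * d) ^ 6 \<le> (4 * k * d) ^ 6" unfolding e_def by (intro power_mono) auto
    also have "\<dots> = 4096 * (d ^ 6 * k ^ 6)" by (simp add: power_mult_distrib)
    also have "\<dots> \<le> 4096 * (d ^ 8 * k ^ 6)"
      using d1 k1 by (intro mult_le_mono power_increasing) auto
    finally show ?thesis using n by simp
  qed
  have half: "n * (4 * e * d) ^ 6 \<le> (n div 2) ^ 2"
  proof -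
    have "n \<le> 3 * (n div 2)" using n5 by linarith
    then have "n * n \<le> (3 * (n div 2)) * (3 * (n div 2))" by (intro mult_le_mono)
    moreover have "n * (9 * (4 * e * d) ^ 6) \<le> n * n" using e6 by (rule mult_le_mono2)
    ultimately have "n * (9 * (4 * e * d) ^ 6) \<le> (3 * (n div 2)) * (3 * (n div 2))"
      by (rule order_trans[rotated])
    then show ?thesis by (simp add: power2_eq_square)
  qed
  \<comment> \<open>Fixes the ratio of 50 to 9: twice the exponent of the number of values, with one
    more factor n for \<open>4 * d\<close>, has to fit into \<open>k div 9\<close>.\<close>
  have qe: "2 * (?q + 7) \<le> e"
  proof -
    have r: "k mod 9 \<le> 8" "9 * e + k mod 9 = k" "50 * ?q \<le> k"
      unfolding e_def by (simp_all add: less_Suc_eq_le[symmetric])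
    show ?thesis
    proof (rule ccontr)
      assume "\<not> 2 * (?q + 7) \<le> e"
      then have "e \<le> 2 * ?q + 13" by simp
      then have "9 * e + k mod 9 \<le> 9 * (2 * ?q + 13) + 8" using r(1) by (intro add_mono mult_le_mono) auto
      then have "k \<le> 18 * ?q + 125" unfolding r(2) by simp
      then show False using r(3) k(1) by linarith
    qed
  qed
  have "?q + 7 = Suc (?q + 6)" by simp
  then have "4 * d * n ^ (?q + 6) \<le> n ^ (?q + 7)"
    using mult_le_mono1[OF n4] by (simp only: power_Suc)
  then have "(4 * d * n ^ (?q + 6)) ^ 2 \<le> (n ^ (?q + 7)) ^ 2" by (rule power_mono) simp
  also have "\<dots> = n ^ (2 * (?q + 7))" by (simp only: power_mult[symmetric] mult.commute)
  also have "\<dots> \<le> n ^ e" using qe n5 by (intro power_increasing) auto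
  finally have sq: "(4 * d * n ^ (?q + 6)) ^ 2 \<le> n ^ e" .
  have "(4 * d * (h * (w * w)) * (4 * e * d) ^ (3 * e)) ^ 2
      = (4 * d * n ^ (?q + 6)) ^ 2 * ((4 * e * d) ^ (3 * e)) ^ 2"
    unfolding M by (rule power_mult_distrib)
  also have "((4 * e * d) ^ (3 * e)) ^ 2 = ((4 * e * d) ^ 6) ^ e"
  proof -
    have "3 * e * 2 = 6 * e" by simp
    then show ?thesis by (simp only: power_mult[symmetric])
  qed
  also have "(4 * d * n ^ (?q + 6)) ^ 2 * ((4 * e * d) ^ 6) ^ e \<le> n ^ e * ((4 * e * d) ^ 6) ^ e"
    using sq by (rule mult_le_mono1)
  also have "\<dots> = (n * (4 * e * d) ^ 6) ^ e" by (rule power_mult_distrib[symmetric])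
  also have "\<dots> \<le> ((n div 2) ^ 2) ^ e" using half by (rule power_mono) simp
  also have "\<dots> = ((n div 2) ^ e) ^ 2" by (simp only: power_mult[symmetric] mult.commute)
  finally show "4 * d * (h * (w * w)) * (4 * e * d) ^ (3 * e) \<le> (n div 2) ^ e"
    by (rule power2_le_imp_le) simp
  \<comment> \<open>X bounds the exponent of n on the left. By \<open>n \<le> 2 ^ n\<close> it
    suffices to compare \<open>n * X + 1\<close> with w, and \<open>X \<le> n * (n - 1)\<close>
    leaves a margin of n^2 below n^3.\<close>
  define X where "X = (?q + 6) * (2 * d + 2)"
  have "?q + 6 \<le> k" using k by linarith
  then have "?q + 6 \<le> n" using k nd by linarith
  moreover have "2 * d + 2 \<le> n - 1" using nd d1 by linarith
  ultimately have X: "X \<le> n * (n - 1)" unfolding X_def by (rule mult_le_mono)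
  have "h * (h * (w * w)) ^ (2 * d + 1) = n ^ (?q + (?q + 6) * (2 * d + 1))"
    unfolding M unfolding h_def by (simp only: power_mult[symmetric] power_add[symmetric])
  also have "\<dots> \<le> n ^ X"
    using n5 by (intro power_increasing) (auto simp: X_def algebra_simps)
  also have "\<dots> \<le> (2 ^ n) ^ X" by (intro power_mono) (auto intro: less_imp_le less_exp)
  also have "\<dots> = 2 ^ (n * X)" by (simp only: power_mult)
  finally have "h * (h * (w * w)) ^ (2 * d + 1) + 1 \<le> 2 ^ (n * X) + 1" by simp
  also have "\<dots> \<le> 2 ^ (n * X + 1)" by simp
  also have "\<dots> < 2 ^ w"
  proof (rule power_strict_increasing)
    have "n * X + 1 \<le> n * (n * (n - 1)) + 1" using X by simp
    also have "1 < n * n" using n5 by (intro less_1_mult) auto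
    then have "n * (n * (n - 1)) + 1 < n * (n * (n - 1)) + n * n" by simp
    also have "\<dots> = n * (n * (n - 1 + 1))" by (simp only: distrib_left mult_1_right)
    also have "\<dots> = w" using n5 by (simp add: w_def power3_eq_cube)
    finally show "n * X + 1 < w" .
  qed simp
  finally show "h * (h * (w * w)) ^ (2 * d + 1) + 1 < 2 ^ w" .
qed

text \<open>The rank is kept below \<open>n ^ (k div 50 - 2)\<close>: one spare factor n pays for
  \<open>d + 1\<close>, the other for the constants and for the last block having number
  \<open>h - 1\<close>. Dividing k by 1000 absorbs the 2 and the rounding.\<close>

lemma rank_bound:
  fixes n d k r :: nat
  assumes k: "250 \<le> k" and n: "4 * d \<le> n" "5 \<le> n"
    and r: "real r \<le> real n powr (1 / 1000 * real k)"
  shows "1 + (r + 1) * (d + 1) < n ^ (k div 50) - 1"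
proof -
  define N where "N = n ^ (k div 50 - 2)"
  have q: "2 \<le> k div 50" using k by simp
  have N1: "1 \<le> N" using n by (simp add: N_def Suc_le_eq)
  have "real k / 1000 \<le> real (k div 50 - 2)" using k by linarith
  then have "real n powr (1 / 1000 * real k) \<le> real n powr real (k div 50 - 2)"
    using n by (intro powr_mono) auto
  also have "\<dots> = real N" using n by (simp add: N_def powr_realpow)
  finally have "r \<le> N" using r by linarith
  then have "(r + 1) * (d + 1) \<le> (2 * N) * n" using N1 n by (intro mult_le_mono) auto
  moreover have "2 * N * n + 3 \<le> N * n * n"
  proof -
    have "2 * N * n + 3 * (N * n) \<le> N * n * n" using n(2) by (simp add: mult_le_mono flip: distrib_right)
    moreover have "1 * 1 \<le> N * n" using N1 n by (intro mult_le_mono) auto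
    ultimately show ?thesis by linarith
  qed
  moreover have "n ^ (k div 50) = N * n * n"
  proof -
    have "n ^ (k div 50) = n ^ (k div 50 - 2 + 2)" by (simp only: le_add_diff_inverse2[OF q])
    then show ?thesis by (simp only: power_add N_def power2_eq_square mult.assoc)
  qed
  ultimately show ?thesis by linarith
qed

theorem theorem1p5:
  "\<exists>(k0::nat) (\<alpha>::real) (\<epsilon>::real). \<alpha> > 0 \<and> \<epsilon> > 0 \<and>
     (\<forall>(d::nat) (k::nat) (n::nat).
        d \<ge> k \<longrightarrow> k \<ge> k0 \<longrightarrow> real n \<ge> \<alpha> * real d ^ 8 * real k ^ 6 \<longrightarrow>
        (\<exists>(\<tau> :: nat vocabulary) (A :: (nat, nat) rel_structure) (B :: (nat, nat) rel_structure).
           kary_structure k \<tau> A \<and> kary_structure k \<tau> B \<and>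
           card (univ A) = n \<and> card (univ B) = n \<and>
           (\<exists>\<phi> \<in> FO_sentences \<tau> k. models A \<phi> \<and> \<not> models B \<phi>) \<and>
           (\<forall>\<psi> \<in> FO_sentences \<tau> d \<union> C_sentences \<tau> d.
              real (qrank \<psi>) \<le> real n powr (\<epsilon> * real k) \<longrightarrow>
              (models A \<psi> \<longleftrightarrow> models B \<psi>))))"
proof (rule exI[of _ 250], rule exI[of _ 40000], rule exI[of _ "1 / 1000"], intro conjI allI impI)
  fix d k n :: nat
  assume k: "k \<le> d" "250 \<le> k" and n: "40000 * real d ^ 8 * real k ^ 6 \<le> real n"
  have "real (40000 * d ^ 8 * k ^ 6) \<le> real n" using n by simp
  then have n': "40000 * d ^ 8 * k ^ 6 \<le> n" by (simp only: of_nat_le_iff)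
  define e where "e = k div 9"
  define h where "h = n ^ (k div 50)"
  define w where "w = n ^ 3"
  note pb = parameter_bounds[OF k(2,1) n', folded e_def h_def w_def]
  define M where "M = h * (w * w)"
  have d1: "1 \<le> d" and e1: "1 \<le> e" using k by (auto simp: e_def)
  have M1: "1 \<le> M" using pb(3,4) by (simp add: M_def Suc_le_eq)
  obtain \<gamma> where \<gamma>: "\<And>u i. u < M \<Longrightarrow> i < 3 * e \<Longrightarrow> \<gamma> u i < n div 2"
    "\<And>A. A \<subseteq> {..<M} \<Longrightarrow> card A \<le> 2 * d \<Longrightarrow> card A \<le> card (unique_nbrs \<gamma> (3 * e) A)"
    using expander_exists[OF e1 d1 M1 pb(1)[folded M_def]] by blast
  obtain T where T: "\<And>t. 1 \<le> t \<Longrightarrow> t < h \<Longrightarrow> inj_linear w (T t)"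
    "\<And>g A B. 1 \<le> g \<Longrightarrow> A \<subseteq> {..<M} \<Longrightarrow> B \<subseteq> {..<M} \<Longrightarrow>
       (\<And>u. u \<in> A \<Longrightarrow> block w u < g) \<Longrightarrow> (\<And>u. u \<in> B \<Longrightarrow> g < block w u) \<Longrightarrow>
       card A \<le> d \<Longrightarrow> card B \<le> d + 1 \<Longrightarrow>
       sum (prog_vec T w) A = sum (prog_vec T w) B \<Longrightarrow> sum (prog_vec T w) B = 0"
    using generic_maps_exist[OF pb(3) pb(2), folded M_def] by blast
  have last: "prog_vec T w (M - 1) \<noteq> 0" "block w (M - 1) = h - 1"
    unfolding M_def using prog_vec_last_nonzero[of h w T] T(1) pb(3,4) by blast+
  interpret compressed_program n d "3 * e" M \<gamma> "prog_preds T w" "block w" "prog_vec T w" "M - 1"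
  proof
    show "1 \<le> 3 * e" "3 \<le> d" using e1 k by auto
    show "M - 1 < M" using M1 by simp
    show "block w p \<le> block w u" if "p \<le> u" for u p
      using that unfolding block_def by (rule div_le_mono)
    show "prog_vec T w u = sum (prog_vec T w) (set (prog_preds T w u))" if "u < M" "1 \<le> block w u" for u
      using prog_vec_step[of h w T u] T(1) pb(3) that unfolding M_def by blast
    show "prog_vec T w (M - 1) \<noteq> 0" by (rule last(1))
    show "p < u" "block w p = block w u \<or> Suc (block w p) = block w u"
      if "u < M" "p \<in> set (prog_preds T w u)" for u p
      using prog_preds_less[OF pb(3) that(2)] by blast+
    show "distinct (u # prog_preds T w u)" "length (prog_preds T w u) \<le> 2" for u
      by (rule prog_preds_distinct[OF pb(3)])+
  qed (fact \<gamma> T(2))+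
  have "9 * e \<le> k" by (simp add: e_def)
  then have arity: "3 * (3 * e) \<le> k" by simp
  have equiv: "models (xor_structure 0) \<psi> \<longleftrightarrow> models (xor_structure 1) \<psi>"
    if "\<psi> \<in> FO_sentences voc d \<union> C_sentences voc d"
      "real (qrank \<psi>) \<le> real n powr (1 / 1000 * real k)" for \<psi>
  proof (rule indistinguishable)
    show "wf_fm voc \<psi>" "fv \<psi> = {}" "card (vars \<psi>) \<le> d"
      using that(1) by (auto simp: FO_sentences_def C_sentences_def)
    show "1 + (qrank \<psi> + 1) * (d + 1) < block w (M - 1)"
      unfolding last(2) h_def by (rule rank_bound[OF k(2) pb(5,6) that(2)])
  qed
  show "\<exists>(\<tau> :: nat vocabulary) (A :: (nat, nat) rel_structure) (B :: (nat, nat) rel_structure).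
           kary_structure k \<tau> A \<and> kary_structure k \<tau> B \<and>
           card (univ A) = n \<and> card (univ B) = n \<and>
           (\<exists>\<phi> \<in> FO_sentences \<tau> k. models A \<phi> \<and> \<not> models B \<phi>) \<and>
           (\<forall>\<psi> \<in> FO_sentences \<tau> d \<union> C_sentences \<tau> d.
              real (qrank \<psi>) \<le> real n powr (1 / 1000 * real k) \<longrightarrow>
              (models A \<psi> \<longleftrightarrow> models B \<psi>))"
  proof (intro exI conjI ballI impI)
    show "kary_structure k voc (xor_structure 0)" "kary_structure k voc (xor_structure 1)"
      by (rule kary_xor_structure[OF arity])+
    show "card (univ (xor_structure 0)) = n" "card (univ (xor_structure 1)) = n"
      by (simp_all only: univ_xor_structure card_lessThan)
  qed (fact distinguishing_sentence[OF arity] equiv)+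
qed simp_all

end
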